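(* Let $\Gamma$ be a finitely generated amenable group and $K$ a field. Then the group algebra $K\Gamma$ embeds (via an injective unital ring homomorphism) into the rank completion $\overline{\mathcal{A}}$ of some ultramatricial algebra $\mathcal{A}$ over $K$ equipped with a rank function arising from a harmonic function on its Bratteli diagram.
   Context: An ultramatricial algebra over $K$ is constructed as follows. For each $n\ge1$ take a finite product $\mathcal{A}_n=\bigoplus_{l=1}^{i_n}\mathrm{Mat}_{d^n_l\times d^n_l}(K)$ and nonnegative integers $K(l,j)=K_n(l,j)$ with $d^{n+1}_j=\sum_{l=1}^{i_n}d^n_l K_n(l,j)$ for all $j$. Let $\phi_n:\mathcal{A}_n\to\mathcal{A}_{n+1}$ be the injective map whose $j$-th component is a block diagonal embedding placing $K_n(l,j)$ copies of the $l$-th factor along the diagonal of $\mathrm{Mat}_{d^{n+1}_j\times d^{n+1}_j}(K)$. The ultramatricial algebra is the direct limit $\mathcal{A}=\varinjlim(\mathcal{A}_n,\phi_n)$. A harmonic function consists of reals $P(d^n_l)\ge0$ with $\sum_l P(d^n_l)=1$ and $P(d^n_l)=\sum_j \frac{d^n_lK_n(l,j)}{d^{n+1}_j}P(d^{n+1}_j)$. It defines a rank on $\mathcal{A}$ by $\mathrm{rk}(a_1\oplus\dots\oplus a_{i_n})=\sum_l P(d^n_l)\,\mathrm{rank}(a_l)/d^n_l$ (compatible with the $\phi_n$). The rank completion $\overline{\mathcal{A}}$ is the completion of $\mathcal{A}$ with respect to the metric $d(x,y)=\mathrm{rk}(x-y)$; it is again a regular ring with a rank function. *)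

theory Defs
  imports "HOL-Algebra.Algebra" "Jordan_Normal_Form.DL_Rank"
begin

definition fin_gen_group :: "('g, 'b) monoid_scheme \<Rightarrow> bool" where
  "fin_gen_group G \<longleftrightarrow> group G \<and>
     (\<exists>S. finite S \<and> S \<subseteq> carrier G \<and> generate G S = carrier G)"

definition amenable_group :: "('g, 'b) monoid_scheme \<Rightarrow> bool" where
  "amenable_group G \<longleftrightarrow> group G \<and>
     (\<forall>S eps. finite S \<and> S \<subseteq> carrier G \<and> (eps::real) > 0 \<longrightarrow>
        (\<exists>F. finite F \<and> F \<noteq> {} \<and> F \<subseteq> carrier G \<and>
           (\<forall>s\<in>S. real (card ((F - (\<lambda>x. s \<otimes>\<^bsub>G\<^esub> x) ` F) \<union> ((\<lambda>x. s \<otimes>\<^bsub>G\<^esub> x) ` F - F)))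
                     < eps * real (card F))))"

definition group_algebra :: "('g, 'b) monoid_scheme \<Rightarrow> ('g \<Rightarrow> 'k::field) ring" where
  "group_algebra G =
    \<lparr> partial_object.carrier = {a. finite {g. a g \<noteq> 0} \<and> (\<forall>g. g \<notin> carrier G \<longrightarrow> a g = 0)},
      monoid.mult = (\<lambda>a b g. if g \<in> carrier G
                then (\<Sum>h\<in>{h. a h \<noteq> 0}. a h * b (inv\<^bsub>G\<^esub> h \<otimes>\<^bsub>G\<^esub> g)) else 0),
      monoid.one = (\<lambda>g. if g = \<one>\<^bsub>G\<^esub> then 1 else 0),
      ring.zero = (\<lambda>g. 0),
      ring.add = (\<lambda>a b g. a g + b g) \<rparr>"

text \<open>Bratteli data: level n (starting at 0) has br_num n factors Mat_{d n l}(K), l < br_num n,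
  and br_mult n l j = K_n(l,j) copies of factor l of level n go into factor j of level n+1.\<close>
record bratteli =
  br_num :: "nat \<Rightarrow> nat"
  br_dim :: "nat \<Rightarrow> nat \<Rightarrow> nat"
  br_mult :: "nat \<Rightarrow> nat \<Rightarrow> nat \<Rightarrow> nat"

definition valid_bratteli :: "bratteli \<Rightarrow> bool" where
  "valid_bratteli B \<longleftrightarrow>
     (\<forall>n. br_num B n \<ge> 1) \<and>
     (\<forall>n l. l < br_num B n \<longrightarrow> br_dim B n l \<ge> 1) \<and>
     (\<forall>n j. j < br_num B (Suc n) \<longrightarrow>
        br_dim B (Suc n) j = (\<Sum>l<br_num B n. br_dim B n l * br_mult B n l j)) \<and>
     \<comment> \<open>injectivity of the connecting maps\<close>
     (\<forall>n l. l < br_num B n \<longrightarrow> (\<exists>j < br_num B (Suc n). br_mult B n l j > 0))"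

definition harmonic :: "bratteli \<Rightarrow> (nat \<Rightarrow> nat \<Rightarrow> real) \<Rightarrow> bool" where
  "harmonic B P \<longleftrightarrow>
     (\<forall>n l. l < br_num B n \<longrightarrow> P n l \<ge> 0) \<and>
     (\<forall>n. (\<Sum>l<br_num B n. P n l) = 1) \<and>
     (\<forall>n l. l < br_num B n \<longrightarrow>
        P n l = (\<Sum>j<br_num B (Suc n).
                   real (br_dim B n l * br_mult B n l j) / real (br_dim B (Suc n) j) * P (Suc n) j))"

definition level_elems :: "bratteli \<Rightarrow> nat \<Rightarrow> 'k::field mat list set" where
  "level_elems B n = {as. length as = br_num B n \<and>
       (\<forall>l < br_num B n. as ! l \<in> carrier_mat (br_dim B n l) (br_dim B n l))}"

fun diag_blocks :: "'k::field mat list \<Rightarrow> 'k mat" where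
  "diag_blocks [] = 0\<^sub>m 0 0"
| "diag_blocks (A # As) =
     (let D = diag_blocks As in
      four_block_mat A (0\<^sub>m (dim_row A) (dim_col D)) (0\<^sub>m (dim_row D) (dim_col A)) D)"

definition phi :: "bratteli \<Rightarrow> nat \<Rightarrow> 'k::field mat list \<Rightarrow> 'k mat list" where
  "phi B n as = map (\<lambda>j. diag_blocks (concat (map (\<lambda>l. replicate (br_mult B n l j) (as ! l))
                                                      [0..<br_num B n])))
                    [0..<br_num B (Suc n)]"

fun phi_iter :: "bratteli \<Rightarrow> nat \<Rightarrow> nat \<Rightarrow> 'k::field mat list \<Rightarrow> 'k mat list" where
  "phi_iter B n 0 as = as"
| "phi_iter B n (Suc k) as = phi B (n + k) (phi_iter B n k as)"

text \<open>Elements of the direct limit A are represented by pairs (n, a) with a in A_n.\<close>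
type_synonym 'k ua_elem = "nat \<times> 'k mat list"

definition ua_elems :: "bratteli \<Rightarrow> 'k::field ua_elem set" where
  "ua_elems B = {(n, as). as \<in> level_elems B n}"

definition lift_to :: "bratteli \<Rightarrow> nat \<Rightarrow> 'k::field ua_elem \<Rightarrow> 'k mat list" where
  "lift_to B m x = phi_iter B (fst x) (m - fst x) (snd x)"

definition ua_add :: "bratteli \<Rightarrow> 'k::field ua_elem \<Rightarrow> 'k ua_elem \<Rightarrow> 'k ua_elem" where
  "ua_add B x y = (let m = max (fst x) (fst y) in
      (m, map2 (+) (lift_to B m x) (lift_to B m y)))"

definition ua_mult :: "bratteli \<Rightarrow> 'k::field ua_elem \<Rightarrow> 'k ua_elem \<Rightarrow> 'k ua_elem" where
  "ua_mult B x y = (let m = max (fst x) (fst y) in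
      (m, map2 (*) (lift_to B m x) (lift_to B m y)))"

definition ua_neg :: "'k::field ua_elem \<Rightarrow> 'k ua_elem" where
  "ua_neg x = (fst x, map uminus (snd x))"

definition ua_one :: "bratteli \<Rightarrow> 'k::field ua_elem" where
  "ua_one B = (0, map (\<lambda>l. 1\<^sub>m (br_dim B 0 l)) [0..<br_num B 0])"

definition ua_zero :: "bratteli \<Rightarrow> 'k::field ua_elem" where
  "ua_zero B = (0, map (\<lambda>l. 0\<^sub>m (br_dim B 0 l) (br_dim B 0 l)) [0..<br_num B 0])"

definition ua_rk :: "bratteli \<Rightarrow> (nat \<Rightarrow> nat \<Rightarrow> real) \<Rightarrow> 'k::field ua_elem \<Rightarrow> real" where
  "ua_rk B P x = (\<Sum>l<br_num B (fst x).
      P (fst x) l * real (vec_space.rank (br_dim B (fst x) l) (snd x ! l))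
        / real (br_dim B (fst x) l))"

definition ua_dist :: "bratteli \<Rightarrow> (nat \<Rightarrow> nat \<Rightarrow> real) \<Rightarrow>
    'k::field ua_elem \<Rightarrow> 'k ua_elem \<Rightarrow> real" where
  "ua_dist B P x y = ua_rk B P (ua_add B x (ua_neg y))"

definition ua_cauchy :: "bratteli \<Rightarrow> (nat \<Rightarrow> nat \<Rightarrow> real) \<Rightarrow>
    (nat \<Rightarrow> 'k::field ua_elem) \<Rightarrow> bool" where
  "ua_cauchy B P s \<longleftrightarrow> (\<forall>k. s k \<in> ua_elems B) \<and>
     (\<forall>e>0. \<exists>N. \<forall>p\<ge>N. \<forall>q\<ge>N. ua_dist B P (s p) (s q) < e)"

definition ua_equiv :: "bratteli \<Rightarrow> (nat \<Rightarrow> nat \<Rightarrow> real) \<Rightarrow>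
    (nat \<Rightarrow> 'k::field ua_elem) \<Rightarrow> (nat \<Rightarrow> 'k ua_elem) \<Rightarrow> bool" where
  "ua_equiv B P s t \<longleftrightarrow> (\<lambda>k. ua_dist B P (s k) (t k)) \<longlonglongrightarrow> 0"

definition ua_class :: "bratteli \<Rightarrow> (nat \<Rightarrow> nat \<Rightarrow> real) \<Rightarrow>
    (nat \<Rightarrow> 'k::field ua_elem) \<Rightarrow> (nat \<Rightarrow> 'k ua_elem) set" where
  "ua_class B P s = {t. ua_cauchy B P t \<and> ua_equiv B P s t}"

definition rank_completion :: "bratteli \<Rightarrow> (nat \<Rightarrow> nat \<Rightarrow> real) \<Rightarrow>
    (nat \<Rightarrow> 'k::field ua_elem) set ring" where
  "rank_completion B P =
    \<lparr> partial_object.carrier = ua_class B P ` {s. ua_cauchy B P s},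
      monoid.mult = (\<lambda>C1 C2. ua_class B P (\<lambda>k. ua_mult B ((SOME s. s \<in> C1) k) ((SOME s. s \<in> C2) k))),
      monoid.one = ua_class B P (\<lambda>k. ua_one B),
      ring.zero = ua_class B P (\<lambda>k. ua_zero B),
      ring.add = (\<lambda>C1 C2. ua_class B P (\<lambda>k. ua_add B ((SOME s. s \<in> C1) k) ((SOME s. s \<in> C2) k))) \<rparr>"

end

theory Submission
  imports Defs "Jordan_Normal_Form.Matrix_Kernel"
begin

text \<open>A chain with one matrix factor per level suffices, so that the completion is von Neumann's
  continuous ring. If \<open>F\<close> is almost invariant, then every finite set \<open>R\<close> splits into
  subsets of right translates of \<open>F\<close> with few edges \<open>x, s x\<close> cut: averaging over all translates
  \<open>F g\<close> yields one with small boundary inside \<open>R\<close> relative to its size; remove it and repeat.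
  By the pigeonhole principle, infinitely many members of a Folner sequence have nearly the same
  frequencies of tile shapes, and matching tiles of equal shape identifies \<open>card Y'\<close> copies of
  \<open>Y\<close> with \<open>card Y\<close> copies of \<open>Y'\<close>, commuting with translations off a small set.
  A diagonal choice gives Folner sets \<open>Y n\<close> for which the compressions of left multiplication to
  multiples of \<open>Y n\<close> form a Cauchy sequence in rank. Boundaries of \<open>Y n\<close> are negligible, hence
  the limit is multiplicative. A nonzero \<open>a\<close> has compressions with a diagonal submatrix of
  proportional size, hence the limit is injective.\<close>

subsection \<open>Rank of matrices over a field\<close>

text \<open>Group elements act by left multiplication, so tiles are right translates
  \<open>F g\<close>: carrying a tile back by \<open>inv g\<close> on the right commutes with every
  left translation, which is why tiles of equal shape are interchangeable. A tile may be any subset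
  of \<open>F g\<close>; there are still at most \<open>2 ^ card F\<close> shapes, so the
  frequencies of a whole sequence lie in one bounded finite-dimensional box. The obstacle is
  divisibility: a chain needs \<open>d n\<close> to divide \<open>d (Suc n)\<close> and block
  diagonal connecting maps, while Folner sets have unrelated sizes. Therefore level \<open>n\<close>
  consists of \<open>k n\<close> copies of \<open>Y n\<close>, where \<open>k n\<close> is the
  product of \<open>card (Y i)\<close> over i < n. Repeating it \<open>card (Y (Suc n))\<close>
  times gives \<open>k n\<close> batches of \<open>card (Y (Suc n))\<close> copies of
  \<open>Y n\<close>, and each batch is regrouped into \<open>card (Y n)\<close> copies of
  \<open>Y (Suc n)\<close>. The errors at level \<open>n\<close> are of order \<open>2 ^ -n\<close>,
  hence summable, for all group elements in a finite set \<open>E n\<close>; these sets exhaust the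
  group, so the finite support of any fixed element lies in \<open>E n\<close> from some level
  on.\<close>

context vec_space begin

lemma rank_mult_le_left:
  assumes A: "A \<in> carrier_mat n m" and B: "B \<in> carrier_mat m p"
  shows "rank (A * B) \<le> rank A"
proof -
  have AB: "A * B \<in> carrier_mat n p" using A B by simp
  have "col_space (A * B) \<subseteq> col_space A"
  proof
    fix y assume "y \<in> col_space (A * B)"
    then obtain x where x: "x \<in> carrier_vec p" "(A * B) *\<^sub>v x = y"
      using col_space_eq[OF AB] B by auto
    then have "A *\<^sub>v (B *\<^sub>v x) = y" using A B by (simp add: assoc_mult_mat_vec)
    then show "y \<in> col_space A" using A B x col_space_eq[OF A] by auto
  qed
  moreover have "subspace class_ring (col_space A) V" "subspace class_ring (col_space (A * B)) V"
    unfolding col_space_def using A AB by (metis cols_dim carrier_matD(1) span_is_subspace)+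
  ultimately have sub: "subspace class_ring (col_space (A * B)) (vs (col_space A))"
    using nested_subspaces by blast
  have fd: "vectorspace.fin_dim class_ring (vs (col_space A))"
    "vectorspace.fin_dim class_ring (vs (col_space (A * B)))"
    unfolding col_space_def using A AB fin_dim_span_cols by blast+
  show ?thesis unfolding rank_def col_space_def[symmetric]
    using vectorspace.subspace_dim[OF subspace_is_vs[OF \<open>subspace class_ring (col_space A) V\<close>] sub fd(1)] fd(2)
    by simp
qed

text \<open>Turns counting into rank estimates: matrices that agree outside a set of columns differ
  by a rank at most the size of that set.\<close>

lemma rank_le_card_nonzero_cols:
  assumes A: "A \<in> carrier_mat n m" 
  shows "rank A \<le> card {j. j < m \<and> col A j \<noteq> 0\<^sub>v n}"
proof -
  have "lin_indpt {}" by (simp add: lin_dep_def)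
  then obtain S where S: "maximal S (\<lambda>T. T \<subseteq> set (cols A) \<and> lin_indpt T)" "finite S"
    using maximal_exists_superset[of "set (cols A)" "\<lambda>T. T \<subseteq> set (cols A) \<and> lin_indpt T" "{}"]
    by blast
  have "S \<subseteq> set (cols A)" "lin_indpt S" using S unfolding maximal_def by auto
  moreover have "S \<subseteq> carrier V" using \<open>S \<subseteq> set (cols A)\<close> A cols_dim[of A] by auto
  ultimately have "0\<^sub>v n \<notin> S" using zero_nin_lin_indpt[of S] \<open>lin_indpt S\<close>
    by (metis UNIV_I module_vec_simps(2) module_vec_simps(3) class_ring_simps(1) one_neq_zero singletonD)
  then have "S \<subseteq> col A ` {j. j < m \<and> col A j \<noteq> 0\<^sub>v n}"
    using \<open>S \<subseteq> set (cols A)\<close> A unfolding cols_def by fastforce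
  then have "card S \<le> card {j. j < m \<and> col A j \<noteq> 0\<^sub>v n}"
    by (rule surj_card_le[rotated]) simp
  then show ?thesis using rank_card_indpt[OF A S(1)] by simp
qed

text \<open>Rows \<open>t i\<close> and columns in \<open>J\<close> form a diagonal submatrix
  without zeros on the diagonal, so entry \<open>t i\<close> of a vanishing combination of these
  columns isolates the coefficient of column \<open>i\<close>. It yields the lower rank bound behind
  injectivity.\<close>

lemma rank_ge_card_diagonal:
  assumes A: "A \<in> carrier_mat n m" and J: "J \<subseteq> {..<m}" and t: "t ` J \<subseteq> {..<n}"
    and diag: "\<And>j. j \<in> J \<Longrightarrow> A $$ (t j, j) \<noteq> 0"
    and off: "\<And>i j. i \<in> J \<Longrightarrow> j \<in> J \<Longrightarrow> i \<noteq> j \<Longrightarrow> A $$ (t i, j) = 0"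
  shows "card J \<le> rank A"
proof -
  have idx: "col A j $ t i = A $$ (t i, j)" if "i \<in> J" "j \<in> J" for i j
    using that A J t by (subst index_col) auto
  have inj: "inj_on (col A) J"
    by (rule inj_onI) (metis idx diag off)
  have finJ: "finite J" using J finite_subset by blast
  have sub: "col A ` J \<subseteq> set (cols A)" using A J unfolding cols_def by auto
  then have car: "col A ` J \<subseteq> carrier_vec n" using A cols_dim by blast
  have z0: "\<forall>v\<in>col A ` J. a v = 0" if z: "lincomb a (col A ` J) = 0\<^sub>v n" for a
  proof safe
      fix i assume i: "i \<in> J"
      then have ti: "t i < n" using t by auto
      have "0 = lincomb a (col A ` J) $ t i" using z ti by (simp add: module_vec_simps)
      also have "\<dots> = (\<Sum>x\<in>col A ` J. a x * x $ t i)" by (rule lincomb_index[OF ti car])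
      also have "\<dots> = (\<Sum>j\<in>J. a (col A j) * A $$ (t i, j))"
        by (subst sum.reindex[OF inj]) (simp add: idx i)
      also have "\<dots> = (\<Sum>j\<in>J. if j = i then a (col A i) * A $$ (t i, i) else 0)"
        by (rule sum.cong) (auto simp: off i)
      also have "\<dots> = a (col A i) * A $$ (t i, i)" using finJ i by simp
      finally show "a (col A i) = 0" using diag[OF i] by (simp add: class_ring_simps)
  qed
  have "lin_indpt (col A ` J)"
    by (rule finite_lin_indpt2) (use finJ car z0 in \<open>auto simp: class_ring_simps\<close>)
  then have "card (col A ` J) \<le> rank A" using rank_ge_card_indpt[OF A sub] by simp
  then show ?thesis using card_image[OF inj] by simp
qed

end

lemma (in kernel) submodule_mat_kernel: "submodule class_ring (mat_kernel A) NC.V"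
  by unfold_locales
    (use A mult_add_distrib_mat_vec[OF A] mult_mat_vec[OF A] mat_kernel[OF A] in \<open>auto simp: class_ring_simps module_vec_simps\<close>)

text \<open>Rank-nullity transfers ranks of block diagonal matrices and of right factors to kernels,
  whose dimensions add up or compare by inclusion.\<close>

lemma (in kernel) rank_plus_kernel_dim: "vec_space.rank nr A + dim = nc"
proof -
  interpret NR: vec_space "TYPE('a)" nr .
  interpret T: linear_map class_ring NC.V NR.V "\<lambda>v. A *\<^sub>v v"
    by unfold_locales
      (use A in \<open>auto simp: module_hom_def module_vec_simps class_ring_simps mult_add_distrib_mat_vec mult_mat_vec\<close>)
  have im: "T.imT = NR.col_space A"
    unfolding T.im_def NR.col_space_eq[OF A] using A by (auto simp: module_vec_simps)
  have ker: "T.kerT = mat_kernel A"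
    unfolding T.ker_def mat_kernel[OF A] by (simp add: module_vec_simps)
  show ?thesis
    using T.rank_nullity[OF NC.fin_dim] 
    unfolding im ker NR.col_space_def NR.rank_def[symmetric] NC.dim_is_n .
qed

lemma rank_plus_kernel_dim:
  assumes "A \<in> carrier_mat n m"
  shows "vec_space.rank n A + kernel.dim m A = m"
  using kernel.rank_plus_kernel_dim[OF kernel.intro[OF assms]] .

lemma rank_four_block_diag:
  fixes B D :: "'a::field mat"
  assumes B: "B \<in> carrier_mat n n" and D: "D \<in> carrier_mat m m"
  shows "vec_space.rank (n + m) (four_block_mat B (0\<^sub>m n m) (0\<^sub>m m n) D) =
    vec_space.rank n B + vec_space.rank m D"
proof -
  have "four_block_mat B (0\<^sub>m n m) (0\<^sub>m m n) D \<in> carrier_mat (n + m) (n + m)"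
    using B D by simp
  from rank_plus_kernel_dim[OF this] rank_plus_kernel_dim[OF B] rank_plus_kernel_dim[OF D]
    kernel_four_block_0_mat[OF refl B D]
  show ?thesis by simp
qed

text \<open>The kernel of \<open>B\<close> lies in the kernel of \<open>A * B\<close>; both matrices
  have \<open>p\<close> columns, so rank-nullity reverses the inequality of dimensions.\<close>

lemma rank_mult_le_right:
  fixes A B :: "'a::field mat"
  assumes A: "A \<in> carrier_mat n m" and B: "B \<in> carrier_mat m p"
  shows "vec_space.rank n (A * B) \<le> vec_space.rank m B"
proof -
  have AB: "A * B \<in> carrier_mat n p" using A B by simp
  interpret KB: kernel m p B by unfold_locales (rule B)
  interpret KAB: kernel n p "A * B" by unfold_locales (rule AB)
  have fin: "KB.Ker.fin_dim" "KAB.Ker.fin_dim"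
    using kernel_basis_exists[OF B] kernel_basis_exists[OF AB]
    unfolding KB.Ker.fin_dim_def KAB.Ker.fin_dim_def KB.Ker.basis_def KAB.Ker.basis_def by auto
  have sub: "subspace class_ring (mat_kernel B) KB.NC.V" "subspace class_ring (mat_kernel (A * B)) KB.NC.V"
    unfolding subspace_def using KB.submodule_mat_kernel KAB.submodule_mat_kernel
    by (auto simp: KB.NC.vectorspace_axioms)
  have "subspace class_ring (mat_kernel B) KAB.VK"
    using KB.NC.nested_subspaces[OF sub(2,1) mat_kernel_mult_subset[OF B A]] .
  from KAB.Ker.subspace_dim[OF this fin(2)] fin(1)
  have "KB.dim \<le> KAB.dim"
    by simp
  then show ?thesis
    using rank_plus_kernel_dim[OF AB] rank_plus_kernel_dim[OF B] by simp
qed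

lemma rank_uminus:
  fixes A :: "'a::field mat"
  assumes A: "A \<in> carrier_mat n m"
  shows "vec_space.rank n (- A) = vec_space.rank n A"
proof -
  have le: "vec_space.rank n (- B) \<le> vec_space.rank n B" if "B \<in> carrier_mat n m" for B :: "'a mat"
  proof -
    have "- B = B * (- 1\<^sub>m m)" using that by simp
    moreover have "- 1\<^sub>m m \<in> carrier_mat m m" by simp
    ultimately show ?thesis using vec_space.rank_mult_le_left[OF that] by metis
  qed
  have "- (- A) = A" using A by (intro eq_matI) auto
  then show ?thesis using le[OF A] le[of "- A"] A by simp
qed

subsection \<open>Rank completion of a chain of matrix algebras\<close>

text \<open>The Kronecker product of the identity matrix of size \<open>k\<close> with
  \<open>A\<close>. Indexing by quotient (number of the copy) and remainder (position in the copy)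
  is the form in which group coordinates enter later.\<close>

definition dup :: "nat \<Rightarrow> nat \<Rightarrow> 'k::field mat \<Rightarrow> 'k mat" where
  "dup n k A = mat (k * n) (k * n)
     (\<lambda>(i, j). if i div n = j div n then A $$ (i mod n, j mod n) else 0)"

lemma dup_carrier [simp]: "dup n k A \<in> carrier_mat (k * n) (k * n)"
  and dim_dup [simp]: "dim_row (dup n k A) = k * n" "dim_col (dup n k A) = k * n"
  by (simp_all add: dup_def)

lemma dup_index:
  "i < k * n \<Longrightarrow> j < k * n \<Longrightarrow>
     dup n k A $$ (i, j) = (if i div n = j div n then A $$ (i mod n, j mod n) else 0)"
  by (simp add: dup_def)

lemma dup_Suc:
  assumes "A \<in> carrier_mat n n"
  shows "dup n (Suc k) A = four_block_mat A (0\<^sub>m n (k * n)) (0\<^sub>m (k * n) n) (dup n k A)"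
proof (cases "n = 0")
  case True
  then show ?thesis using assms by (intro eq_matI) auto
next
  case False
  show ?thesis
  proof (intro eq_matI)
    fix i j
    assume "i < dim_row (four_block_mat A (0\<^sub>m n (k * n)) (0\<^sub>m (k * n) n) (dup n k A))"
      and "j < dim_col (four_block_mat A (0\<^sub>m n (k * n)) (0\<^sub>m (k * n) n) (dup n k A))"
    then have ij: "i < n + k * n" "j < n + k * n" using assms by auto
    have *: "(i - n) mod n = i mod n" "Suc ((i - n) div n) = i div n" if "\<not> i < n" for i
      using that False by (simp_all add: le_mod_geq le_div_geq)
    have **: "i div n \<noteq> 0" if "\<not> i < n" for i using *(2)[OF that] by linarith
    show "dup n (Suc k) A $$ (i, j) =
        four_block_mat A (0\<^sub>m n (k * n)) (0\<^sub>m (k * n) n) (dup n k A) $$ (i, j)"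
      using ij assms *(1) *(2)[of i, symmetric] *(2)[of j, symmetric] ** [of i] **[of j]
      by (auto simp: dup_index)
  qed (use assms in auto)
qed

lemma dup_0: "dup n 0 A = 0\<^sub>m 0 0"
  by (intro eq_matI) auto

lemma diag_blocks_replicate:
  assumes "A \<in> carrier_mat n n"
  shows "diag_blocks (replicate k A) = dup n k A"
  by (induction k) (use assms in \<open>auto simp: dup_0 dup_Suc Let_def\<close>)

lemma rank_dup:
  fixes A :: "'k::field mat"
  assumes "A \<in> carrier_mat n n"
  shows "vec_space.rank (k * n) (dup n k A) = k * vec_space.rank n A"
proof (induction k)
  case 0
  show ?case using vec_space.rank_le_nc[of "dup n 0 A" 0 0] by (simp add: dup_0)
next
  case (Suc k)
  show ?case
    using rank_four_block_diag[OF assms dup_carrier] Suc.IH dup_Suc[OF assms] by simp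
qed

lemma dup_add:
  assumes "A \<in> carrier_mat n n" "B \<in> carrier_mat n n"
  shows "dup n k (A + B) = dup n k A + dup n k B"
proof (cases "n = 0")
  case False
  then show ?thesis using assms by (intro eq_matI) (auto simp: dup_index)
qed (intro eq_matI, auto)

lemma dup_uminus:
  assumes "A \<in> carrier_mat n n"
  shows "dup n k (- A) = - dup n k A"
proof (cases "n = 0")
  case False
  then show ?thesis using assms by (intro eq_matI) (auto simp: dup_index)
qed (intro eq_matI, auto)

lemma dup_mult:
  assumes "A \<in> carrier_mat n n" "B \<in> carrier_mat n n"
  shows "dup n k (A * B) = dup n k A * dup n k B"
proof (induction k)
  case 0
  show ?case by (intro eq_matI) auto
next
  case (Suc k)
  have "A * B \<in> carrier_mat n n" using assms by simp
  then show ?case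
    using Suc.IH assms
    by (simp add: dup_Suc left_add_zero_mat[OF mult_carrier_mat[OF dup_carrier dup_carrier]] mult_four_block_mat[OF _ zero_carrier_mat zero_carrier_mat dup_carrier _ zero_carrier_mat zero_carrier_mat dup_carrier])
qed

text \<open>Copy numbers compose like two-digit expansions: two quotients by \<open>n\<close> are
  equal iff they have the same quotient and the same remainder by \<open>k\<close>. This makes the
  connecting maps functorial.\<close>

lemma dup_dup:
  assumes "n > 0" "k > 0"
  shows "dup (k * n) l (dup n k A) = dup n (l * k) A"
proof (intro eq_matI)
  fix i j assume "i < dim_row (dup n (l * k) A)" "j < dim_col (dup n (l * k) A)"
  then have ij: "i < l * (k * n)" "j < l * (k * n)" by (simp_all add: ac_simps)
  have m: "i mod (k * n) = n * (i div n mod k) + i mod n" for i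
    by (metis mod_mult2_eq mult.commute)
  have d: "i div (k * n) = i div n div k" for i
    by (metis div_mult2_eq mult.commute)
  have m1: "i mod (k * n) div n = i div n mod k" "i mod (k * n) mod n = i mod n" for i
    using assms by (simp_all add: m)
  have e: "i div n = j div n \<longleftrightarrow> i div n div k = j div n div k \<and> i div n mod k = j div n mod k"
    by (metis div_mult_mod_eq)
  have lt: "i mod (k * n) < k * n" for i using assms by simp
  show "dup (k * n) l (dup n k A) $$ (i, j) = dup n (l * k) A $$ (i, j)"
    using ij by (simp add: dup_index lt m1 d e mult.assoc)
qed (simp_all add: ac_simps)

lemma dup_1: "A \<in> carrier_mat n n \<Longrightarrow> dup n (Suc 0) A = A"
  by (intro eq_matI) (auto simp: dup_index)

lemma dup_one: 
  assumes "n > 0" shows "dup n k (1\<^sub>m n) = 1\<^sub>m (k * n)"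
proof (intro eq_matI)
  fix i j assume "i < dim_row (1\<^sub>m (k * n))" "j < dim_col (1\<^sub>m (k * n))"
  then show "dup n k (1\<^sub>m n) $$ (i, j) = 1\<^sub>m (k * n) $$ (i, j)"
    using assms by (auto simp: dup_index) (metis div_mult_mod_eq)
qed auto

text \<open>Data of a UHF algebra: one vertex per level and \<open>d (Suc n) div d n\<close> edges
  between consecutive levels. Normalization forces the harmonic function to be 1, so the rank is the
  matrix rank divided by the size.\<close>

definition chain_bratteli :: "(nat \<Rightarrow> nat) \<Rightarrow> bratteli" where
  "chain_bratteli d = \<lparr>br_num = (\<lambda>_. 1), br_dim = (\<lambda>n _. d n), br_mult = (\<lambda>n _ _. d (Suc n) div d n)\<rparr>"

locale dim_chain =
  fixes d :: "nat \<Rightarrow> nat"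
  assumes pos: "d n > 0" and dvd_Suc: "d n dvd d (Suc n)"
begin

abbreviation "B \<equiv> chain_bratteli d"
abbreviation P :: "nat \<Rightarrow> nat \<Rightarrow> real" where "P \<equiv> \<lambda>_ _. 1"

lemma B_simps [simp]: "br_num B n = 1" "br_dim B n l = d n" "br_mult B n l j = d (Suc n) div d n"
  by (simp_all add: chain_bratteli_def)

lemma dvd_mono: "m \<le> n \<Longrightarrow> d m dvd d n"
  by (induction n rule: dec_induct) (auto intro: dvd_trans dvd_Suc)

lemma div_mult_d: "m \<le> n \<Longrightarrow> d n div d m * d m = d n"
  using dvd_mono by simp

lemma valid: "valid_bratteli B"
  unfolding valid_bratteli_def
  using pos dvd_Suc by (auto simp: Suc_le_eq div_greater_zero_iff intro!: dvd_imp_le)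

lemma harmonic: "harmonic B P"
  unfolding harmonic_def using pos dvd_Suc by (auto simp: less_imp_neq[OF pos, symmetric])

definition up :: "nat \<Rightarrow> nat \<Rightarrow> 'k::field mat \<Rightarrow> 'k mat" where
  "up n m A = dup (d n) (d m div d n) A"

lemma up_carrier: "n \<le> m \<Longrightarrow> up n m A \<in> carrier_mat (d m) (d m)"
  unfolding up_def using dup_carrier[of "d n" "d m div d n"] by (simp add: div_mult_d)

lemma up_up: 
  assumes "n \<le> m" "m \<le> l" shows "up m l (up n m A) = up n l A"
proof -
  have "d m div d n > 0" using pos dvd_mono[OF assms(1)]
    by (simp add: div_greater_zero_iff dvd_imp_le)
  moreover have "d l div d m * (d m div d n) = d l div d n"
    using dvd_mono[OF assms(1)] dvd_mono[OF assms(2)] by (simp add: div_mult_swap)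
  ultimately show ?thesis
    using dup_dup[of "d n" "d m div d n" "d l div d m" A] pos[of n] div_mult_d[OF assms(1)]
    by (simp add: up_def)
qed

lemma phi_single:
  assumes "A \<in> carrier_mat (d n) (d n)"
  shows "phi B n [A] = [up n (Suc n) A]"
  using diag_blocks_replicate[OF assms] by (simp add: phi_def up_def)

lemma up_self: "A \<in> carrier_mat (d n) (d n) \<Longrightarrow> up n n A = A"
  using pos[of n] by (simp add: up_def dup_1)

lemma phi_iter_single:
  assumes "A \<in> carrier_mat (d n) (d n)"
  shows "phi_iter B n k [A] = [up n (n + k) A]"
proof (induction k)
  case 0
  show ?case using assms by (simp add: up_self)
next
  case (Suc k)
  then show ?case by (simp add: phi_single up_carrier up_up)
qed

text \<open>Image at level \<open>m\<close> of the only matrix in \<open>x\<close>, meaningful for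
  \<open>fst x \<le> m\<close>. It reduces all algebra in the limit to matrices at one common
  level.\<close>

definition rep_at :: "nat \<Rightarrow> 'k::field ua_elem \<Rightarrow> 'k mat" where
  "rep_at m x = up (fst x) m (hd (snd x))"

lemma elemsE:
  assumes "x \<in> ua_elems B"
  obtains n A where "x = (n, [A])" "A \<in> carrier_mat (d n) (d n)"
  using assms unfolding ua_elems_def level_elems_def
  by (cases x) (auto simp: length_Suc_conv)

lemma elemsI: "A \<in> carrier_mat (d n) (d n) \<Longrightarrow> (n, [A]) \<in> ua_elems B"
  by (simp add: ua_elems_def level_elems_def)

lemma rep_at_carrier: "fst x \<le> m \<Longrightarrow> rep_at m x \<in> carrier_mat (d m) (d m)"
  by (simp add: rep_at_def up_carrier)

lemma lift_to_eq: 
  assumes "x \<in> ua_elems B" "fst x \<le> m" shows "lift_to B m x = [rep_at m x]"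
  using assms by (elim elemsE) (simp add: lift_to_def phi_iter_single rep_at_def)

lemma ua_add_eq:
  assumes "x \<in> ua_elems B" "y \<in> ua_elems B"
  shows "ua_add B x y = (max (fst x) (fst y), [rep_at (max (fst x) (fst y)) x + rep_at (max (fst x) (fst y)) y])"
  using assms by (simp add: ua_add_def Let_def lift_to_eq)

lemma ua_mult_eq:
  assumes "x \<in> ua_elems B" "y \<in> ua_elems B"
  shows "ua_mult B x y = (max (fst x) (fst y), [rep_at (max (fst x) (fst y)) x * rep_at (max (fst x) (fst y)) y])"
  using assms by (simp add: ua_mult_def Let_def lift_to_eq)

lemma ua_add_elems [simp]: "x \<in> ua_elems B \<Longrightarrow> y \<in> ua_elems B \<Longrightarrow> ua_add B x y \<in> ua_elems B"
  by (simp add: ua_add_eq elemsI rep_at_carrier)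

lemma ua_mult_elems [simp]: "x \<in> ua_elems B \<Longrightarrow> y \<in> ua_elems B \<Longrightarrow> ua_mult B x y \<in> ua_elems B"
  unfolding ua_mult_eq by (intro elemsI mult_carrier_mat[OF rep_at_carrier rep_at_carrier]) simp_all

lemma ua_neg_elems [simp]: "x \<in> ua_elems B \<Longrightarrow> ua_neg x \<in> ua_elems B"
  by (elim elemsE) (simp add: ua_neg_def elemsI)

lemma rep_at_add:
  assumes "x \<in> ua_elems B" "y \<in> ua_elems B" "fst x \<le> m" "fst y \<le> m"
  shows "rep_at m (ua_add B x y) = rep_at m x + rep_at m y"
proof -
  let ?l = "max (fst x) (fst y)"
  have "rep_at m (ua_add B x y) = up ?l m (rep_at ?l x + rep_at ?l y)"
    using assms by (simp add: ua_add_eq rep_at_def)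
  also have "\<dots> = up ?l m (rep_at ?l x) + up ?l m (rep_at ?l y)"
    unfolding up_def by (rule dup_add) (simp_all add: rep_at_carrier)
  finally show ?thesis using assms by (simp add: rep_at_def up_up)
qed

lemma rep_at_mult:
  assumes "x \<in> ua_elems B" "y \<in> ua_elems B" "fst x \<le> m" "fst y \<le> m"
  shows "rep_at m (ua_mult B x y) = rep_at m x * rep_at m y"
proof -
  let ?l = "max (fst x) (fst y)"
  have "rep_at m (ua_mult B x y) = up ?l m (rep_at ?l x * rep_at ?l y)"
    using assms by (simp add: ua_mult_eq rep_at_def)
  also have "\<dots> = up ?l m (rep_at ?l x) * up ?l m (rep_at ?l y)"
    unfolding up_def by (rule dup_mult) (simp_all add: rep_at_carrier)
  finally show ?thesis using assms by (simp add: rep_at_def up_up)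
qed

lemma rep_at_neg:
  assumes "x \<in> ua_elems B" shows "rep_at m (ua_neg x) = - rep_at m x"
  using assms by (elim elemsE) (simp add: ua_neg_def rep_at_def up_def dup_uminus)

definition nrank :: "nat \<Rightarrow> 'k::field mat \<Rightarrow> real" where
  "nrank m A = real (vec_space.rank (d m) A) / real (d m)"

text \<open>Copying multiplies rank and size by the same factor. This is what makes the rank well
  defined on the direct limit.\<close>

lemma nrank_up:
  assumes "n \<le> m" "A \<in> carrier_mat (d n) (d n)"
  shows "nrank m (up n m A) = nrank n A"
proof -
  have "vec_space.rank (d m) (up n m A) = d m div d n * vec_space.rank (d n) A"
    using rank_dup[OF assms(2), of "d m div d n"] by (simp add: up_def div_mult_d[OF assms(1)])
  moreover have "real (d m div d n) = real (d m) / real (d n)"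
    using dvd_mono[OF assms(1)] by (simp add: real_of_nat_div)
  ultimately show ?thesis using pos[of m] by (simp add: nrank_def)
qed

lemma ua_rk_eq:
  assumes "x \<in> ua_elems B" "fst x \<le> m" shows "ua_rk B P x = nrank m (rep_at m x)"
  using assms by (elim elemsE) (simp add: ua_rk_def rep_at_def nrank_up, simp add: nrank_def)

text \<open>Any level above both elements may be used, so each metric inequality below can be
  checked for matrices of a single size.\<close>

lemma ua_dist_eq:
  assumes "x \<in> ua_elems B" "y \<in> ua_elems B" "fst x \<le> m" "fst y \<le> m"
  shows "ua_dist B P x y = nrank m (rep_at m x - rep_at m y)"
proof -
  have "fst (ua_neg y) = fst y" "fst (ua_add B x (ua_neg y)) \<le> m"
    using assms by (simp_all add: ua_add_def Let_def ua_neg_def)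
  then have "ua_dist B P x y = nrank m (rep_at m x + - rep_at m y)"
    unfolding ua_dist_def using assms by (simp add: ua_rk_eq rep_at_add rep_at_neg)
  then show ?thesis using assms rep_at_carrier[of x m] rep_at_carrier[of y m]
    by (simp add: minus_add_uminus_mat)
qed

lemma nrank_add:
  assumes "A \<in> carrier_mat (d m) (d m)" "C \<in> carrier_mat (d m) (d m)"
  shows "nrank m (A + C) \<le> nrank m A + nrank m C"
  using vec_space.rank_subadditive[OF assms] pos[of m]
  by (simp add: nrank_def divide_simps)

lemma nrank_mult:
  assumes "A \<in> carrier_mat (d m) (d m)" "C \<in> carrier_mat (d m) (d m)"
  shows "nrank m (A * C) \<le> nrank m A" "nrank m (A * C) \<le> nrank m C"
  using vec_space.rank_mult_le_left[OF assms] rank_mult_le_right[OF assms] pos[of m]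
  by (simp_all add: nrank_def divide_simps)

lemma nrank_uminus:
  assumes "A \<in> carrier_mat (d m) (d m)" shows "nrank m (- A) = nrank m A"
  using rank_uminus[OF assms] by (simp add: nrank_def)

lemma nrank_zero: "nrank m (0\<^sub>m (d m) (d m)) = 0"
  by (simp add: nrank_def vec_space.rank_0I)

lemma dist_nonneg: "ua_dist B P x y \<ge> 0"
  unfolding ua_dist_def ua_rk_def by (simp add: sum_nonneg)

lemma dist_self: "x \<in> ua_elems B \<Longrightarrow> ua_dist B P x x = 0"
  using rep_at_carrier[of x "fst x"] nrank_zero by (simp add: ua_dist_eq[of _ _ "fst x"])

lemma dist_sym:
  assumes "x \<in> ua_elems B" "y \<in> ua_elems B"
  shows "ua_dist B P x y = ua_dist B P y x"
proof -
  define m where "m = max (fst x) (fst y)"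
  have m: "fst x \<le> m" "fst y \<le> m" by (simp_all add: m_def)
  note c = rep_at_carrier[OF m(1)] rep_at_carrier[OF m(2)]
  have "rep_at m x - rep_at m y = - (rep_at m y - rep_at m x)" using c by (intro eq_matI) auto
  then show ?thesis using ua_dist_eq[OF assms m] ua_dist_eq[OF assms(2,1) m(2,1)] c nrank_uminus
    by (metis minus_carrier_mat)
qed

lemma dist_triangle:
  assumes "x \<in> ua_elems B" "y \<in> ua_elems B" "z \<in> ua_elems B"
  shows "ua_dist B P x z \<le> ua_dist B P x y + ua_dist B P y z"
proof -
  define m where "m = max (fst x) (max (fst y) (fst z))"
  have m: "fst x \<le> m" "fst y \<le> m" "fst z \<le> m" by (simp_all add: m_def)
  note c = rep_at_carrier[OF m(1)] rep_at_carrier[OF m(2)] rep_at_carrier[OF m(3)]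
  have e: "rep_at m x - rep_at m z = (rep_at m x - rep_at m y) + (rep_at m y - rep_at m z)" 
    using c by (intro eq_matI) auto
  have "nrank m (rep_at m x - rep_at m z) \<le> nrank m (rep_at m x - rep_at m y) + nrank m (rep_at m y - rep_at m z)"
    unfolding e by (intro nrank_add minus_carrier_mat c)
  then show ?thesis using assms m by (simp add: ua_dist_eq[of _ _ m])
qed

lemma dist_add:
  assumes "x \<in> ua_elems B" "y \<in> ua_elems B" "x' \<in> ua_elems B" "y' \<in> ua_elems B"
  shows "ua_dist B P (ua_add B x y) (ua_add B x' y') \<le> ua_dist B P x x' + ua_dist B P y y'"
proof -
  define m where "m = max (max (fst x) (fst y)) (max (fst x') (fst y'))"
  have m: "fst x \<le> m" "fst y \<le> m" "fst x' \<le> m" "fst y' \<le> m" by (simp_all add: m_def)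
  have m': "fst (ua_add B x y) \<le> m" "fst (ua_add B x' y') \<le> m" 
    using m by (simp_all add: ua_add_def Let_def)
  note c = m[THEN rep_at_carrier]
  have e: "(rep_at m x + rep_at m y) - (rep_at m x' + rep_at m y') = (rep_at m x - rep_at m x') + (rep_at m y - rep_at m y')" 
    using c by (intro eq_matI) auto
  have "nrank m ((rep_at m x + rep_at m y) - (rep_at m x' + rep_at m y')) \<le>
      nrank m (rep_at m x - rep_at m x') + nrank m (rep_at m y - rep_at m y')"
    unfolding e by (intro nrank_add minus_carrier_mat c)
  then show ?thesis using assms m m' by (simp add: ua_dist_eq[of _ _ m] rep_at_add)
qed

text \<open>Telescoping: \<open>x y - x' y' = (x - x') y + x' (y - y')\<close>, and the rank of a
  product is at most that of either factor.\<close>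

lemma dist_mult:
  assumes "x \<in> ua_elems B" "y \<in> ua_elems B" "x' \<in> ua_elems B" "y' \<in> ua_elems B"
  shows "ua_dist B P (ua_mult B x y) (ua_mult B x' y') \<le> ua_dist B P x x' + ua_dist B P y y'"
proof -
  define m where "m = max (max (fst x) (fst y)) (max (fst x') (fst y'))"
  have m: "fst x \<le> m" "fst y \<le> m" "fst x' \<le> m" "fst y' \<le> m" by (simp_all add: m_def)
  have m': "fst (ua_mult B x y) \<le> m" "fst (ua_mult B x' y') \<le> m" 
    using m by (simp_all add: ua_mult_def Let_def)
  note c = m[THEN rep_at_carrier]
  have e: "rep_at m x * rep_at m y - rep_at m x' * rep_at m y' =
      (rep_at m x - rep_at m x') * rep_at m y + rep_at m x' * (rep_at m y - rep_at m y')"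
  proof -
    have "(rep_at m x - rep_at m x') * rep_at m y + rep_at m x' * (rep_at m y - rep_at m y') =
        (rep_at m x * rep_at m y - rep_at m x' * rep_at m y) + (rep_at m x' * rep_at m y - rep_at m x' * rep_at m y')"
      using c by (simp add: minus_mult_distrib_mat[of _ "d m" "d m"] mult_minus_distrib_mat[of _ "d m" "d m"])
    also have "\<dots> = rep_at m x * rep_at m y - rep_at m x' * rep_at m y'"
      using c by (intro eq_matI) auto
    finally show ?thesis by simp
  qed
  have c1: "rep_at m x - rep_at m x' \<in> carrier_mat (d m) (d m)" "rep_at m y - rep_at m y' \<in> carrier_mat (d m) (d m)"
    using c by auto
  have "nrank m (rep_at m x * rep_at m y - rep_at m x' * rep_at m y') \<le>
      nrank m (rep_at m x - rep_at m x') + nrank m (rep_at m y - rep_at m y')"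
    unfolding e
    using nrank_add[of "(rep_at m x - rep_at m x') * rep_at m y" m "rep_at m x' * (rep_at m y - rep_at m y')"]
      nrank_mult(1)[OF c1(1) c(2)] nrank_mult(2)[OF c(3) c1(2)] c1 c
    by (smt (verit) mult_carrier_mat)
  then show ?thesis using assms m m'
    by (simp add: ua_dist_eq[of _ _ m] rep_at_mult)
qed

section \<open>Classes of Cauchy sequences and their arithmetic\<close>

lemma cauchy_elems: "ua_cauchy B P s \<Longrightarrow> s k \<in> ua_elems B"
  by (simp add: ua_cauchy_def)

lemma equiv_refl: "(\<And>k. s k \<in> ua_elems B) \<Longrightarrow> ua_equiv B P s s"
  by (simp add: ua_equiv_def dist_self)

lemma equiv_sym:
  assumes "\<And>k. s k \<in> ua_elems B" "\<And>k. t k \<in> ua_elems B" "ua_equiv B P s t"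
  shows "ua_equiv B P t s"
  using assms by (simp add: ua_equiv_def dist_sym)

lemma equivI_le:
  assumes "\<And>k. ua_dist B P (s k) (t k) \<le> f k" "f \<longlonglongrightarrow> 0"
  shows "ua_equiv B P s t"
  unfolding ua_equiv_def
  by (rule tendsto_sandwich[OF _ _ tendsto_const assms(2)]) (simp_all add: assms dist_nonneg)

lemma equiv_trans:
  assumes "\<And>k. s k \<in> ua_elems B" "\<And>k. t k \<in> ua_elems B" "\<And>k. u k \<in> ua_elems B"
    and "ua_equiv B P s t" "ua_equiv B P t u"
  shows "ua_equiv B P s u"
  by (rule equivI_le[OF dist_triangle[OF assms(1-3)]])
    (use assms(4,5) tendsto_add_zero in \<open>auto simp: ua_equiv_def\<close>)

text \<open>Only the members of a class are required to be Cauchy, not the sequence that names it.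
  Hence termwise sums and products can be compared without first showing them Cauchy.\<close>

lemma class_eqI:
  assumes "\<And>k. s k \<in> ua_elems B" "\<And>k. t k \<in> ua_elems B" "ua_equiv B P s t"
  shows "ua_class B P s = ua_class B P t"
  unfolding ua_class_def using assms equiv_trans equiv_sym cauchy_elems by blast

text \<open>The operations of \<open>rank_completion\<close> act on representatives picked by
  \<open>SOME\<close>; this relates the picked one to the given sequence.\<close>

lemma class_rep:
  assumes "ua_cauchy B P s"
  defines "r \<equiv> SOME t. t \<in> ua_class B P s"
  shows "ua_cauchy B P r" "ua_equiv B P r s"
proof -
  have "s \<in> ua_class B P s"
    using assms(1) equiv_refl cauchy_elems by (auto simp: ua_class_def)
  then have "r \<in> ua_class B P s" unfolding r_def by (rule someI[of "\<lambda>t. t \<in> ua_class B P s"])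
  then show "ua_cauchy B P r" "ua_equiv B P r s"
    using equiv_sym assms(1) cauchy_elems unfolding ua_class_def by blast+
qed

lemma completion_add:
  assumes s: "ua_cauchy B P s" and t: "ua_cauchy B P t"
  shows "ua_class B P s \<oplus>\<^bsub>rank_completion B P\<^esub> ua_class B P t = ua_class B P (\<lambda>k. ua_add B (s k) (t k))"
proof -
  note r = class_rep[OF s] class_rep[OF t]
  note e = cauchy_elems[OF s] cauchy_elems[OF t] cauchy_elems[OF r(1)] cauchy_elems[OF r(3)]
  show ?thesis unfolding rank_completion_def
    using tendsto_add_zero[OF r(2,4)[unfolded ua_equiv_def]] e
    by (simp, intro class_eqI equivI_le[OF dist_add]) simp_all
qed

lemma completion_mult:
  assumes s: "ua_cauchy B P s" and t: "ua_cauchy B P t"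
  shows "ua_class B P s \<otimes>\<^bsub>rank_completion B P\<^esub> ua_class B P t = ua_class B P (\<lambda>k. ua_mult B (s k) (t k))"
proof -
  note r = class_rep[OF s] class_rep[OF t]
  note e = cauchy_elems[OF s] cauchy_elems[OF t] cauchy_elems[OF r(1)] cauchy_elems[OF r(3)]
  show ?thesis unfolding rank_completion_def
    using tendsto_add_zero[OF r(2,4)[unfolded ua_equiv_def]] e
    by (simp, intro class_eqI equivI_le[OF dist_mult]) simp_all
qed

lemma class_eqD:
  assumes "ua_cauchy B P s" "ua_cauchy B P t" "ua_class B P s = ua_class B P t"
  shows "ua_equiv B P s t"
proof -
  have "t \<in> ua_class B P t"
    using assms(2) equiv_refl cauchy_elems by (auto simp: ua_class_def)
  then show ?thesis using assms(3) by (auto simp: ua_class_def)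
qed

lemma dist_same_level:
  assumes "A \<in> carrier_mat (d n) (d n)" "C \<in> carrier_mat (d n) (d n)"
  shows "ua_dist B P (n, [A]) (n, [C]) = nrank n (A - C)"
  using ua_dist_eq[OF elemsI[OF assms(1)] elemsI[OF assms(2)], of n] assms
  by (simp add: rep_at_def up_self)

lemma dist_next_level:
  assumes "A \<in> carrier_mat (d n) (d n)" "C \<in> carrier_mat (d (Suc n)) (d (Suc n))"
  shows "ua_dist B P (n, [A]) (Suc n, [C]) = nrank (Suc n) (up n (Suc n) A - C)"
  using ua_dist_eq[OF elemsI[OF assms(1)] elemsI[OF assms(2)], of "Suc n"] assms
  by (simp add: rep_at_def up_self)

lemma cauchy_geometric:
  assumes s: "\<And>k. s k \<in> ua_elems B" and c: "\<And>n. n \<ge> N \<Longrightarrow> ua_dist B P (s n) (s (Suc n)) \<le> c / 2 ^ n"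
  shows "ua_cauchy B P s"
proof -
  have "0 \<le> c / 2 ^ N" using order_trans[OF dist_nonneg c[of N]] by simp
  then have "c \<ge> 0" by (metis zero_le_divide_iff zero_less_power zero_less_numeral not_less)
  \<comment> \<open>The right-hand side is the exact geometric sum of the \<open>k\<close> terms
    starting at \<open>c / 2 ^ p\<close>, so the induction closes without loss.\<close>
  have b: "ua_dist B P (s p) (s (p + k)) \<le> 2 * c / 2 ^ p - 2 * c / 2 ^ (p + k)" if "p \<ge> N" for p k
  proof (induction k)
    case 0
    show ?case using dist_self[OF s] by simp
  next
    case (Suc k)
    have "ua_dist B P (s p) (s (p + Suc k)) \<le> ua_dist B P (s p) (s (p + k)) + c / 2 ^ (p + k)"
      using dist_triangle[OF s s s, of p "p + Suc k" "p + k"] c[of "p + k"] that by simp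
    moreover have "c / 2 ^ (p + k) = 2 * c / 2 ^ (p + k) - 2 * c / 2 ^ (p + Suc k)" by simp
    ultimately show ?case using Suc.IH by linarith
  qed
  have b': "ua_dist B P (s p) (s q) \<le> 2 * c / 2 ^ M" if "M \<ge> N" "p \<ge> M" "q \<ge> M" for p q M
  proof -
    have *: "ua_dist B P (s p) (s q) \<le> 2 * c / 2 ^ M" if "p \<le> q" "p \<ge> M" for p q
    proof -
      have "ua_dist B P (s p) (s q) \<le> 2 * c / 2 ^ p"
        using b[of p "q - p"] that \<open>M \<ge> N\<close> \<open>c \<ge> 0\<close> 
        by (smt (verit) divide_nonneg_nonneg le_add_diff_inverse le_trans zero_le_power)
      also have "\<dots> \<le> 2 * c / 2 ^ M" using that \<open>c \<ge> 0\<close>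
        by (intro divide_left_mono power_increasing) auto
      finally show ?thesis .
    qed
    show ?thesis using *[of p q] *[of q p] dist_sym[OF s s, of p q] that by (cases "p \<le> q") auto
  qed
  have lim: "(\<lambda>M. 2 * c / 2 ^ M) \<longlonglongrightarrow> 0" 
    using tendsto_mult[OF tendsto_const[of "2 * c"] LIMSEQ_inverse_realpow_zero[of 2]]
    by (simp add: divide_inverse)
  show ?thesis unfolding ua_cauchy_def
  proof (intro conjI allI impI)
    fix e :: real assume "e > 0"
    with lim have "eventually (\<lambda>M. 2 * c / 2 ^ M < e) sequentially"
      using order_tendstoD(2) by blast
    then obtain M0 where "\<And>M. M \<ge> M0 \<Longrightarrow> 2 * c / 2 ^ M < e" 
      by (auto simp: eventually_sequentially)
    then show "\<exists>N. \<forall>p\<ge>N. \<forall>q\<ge>N. ua_dist B P (s p) (s q) < e"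
      using b'[of "max N M0"] by (intro exI[of _ "max N M0"]) (smt (verit) max.cobounded1 max.cobounded2)
  qed (rule s)
qed

end

subsection \<open>Tilings by translates of a Folner set\<close>

context group begin

text \<open>\<open>x \<otimes> inv g \<in> F\<close> says that \<open>x\<close> lies in the
  translate \<open>F g\<close>. Double counting over \<open>g\<close>: every point of
  \<open>R\<close> lies in exactly \<open>card F\<close> translates, and every edge from
  \<open>x\<close> to \<open>s \<otimes> x\<close> is cut by at most
  \<open>\<delta> * card F\<close> of them. If the ratio of cut edges to points were too large for
  every translate, these sums would contradict each other.\<close>

lemma greedy_piece:
  fixes \<delta> :: real
  assumes F: "finite F" "F \<noteq> {}" "F \<subseteq> carrier G" and S: "finite S" "S \<subseteq> carrier G"
    and inv: "\<And>s. s \<in> S \<Longrightarrow> real (card ((F - (\<otimes>) s ` F) \<union> ((\<otimes>) s ` F - F))) \<le> \<delta> * card F"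
    and R: "finite R" "R \<noteq> {}" "R \<subseteq> carrier G"
  shows "\<exists>g\<in>carrier G. {x\<in>R. x \<otimes> inv g \<in> F} \<noteq> {} \<and>
    (\<Sum>s\<in>S. real (card {x\<in>R. s \<otimes> x \<in> R \<and> (x \<otimes> inv g \<in> F) \<noteq> (s \<otimes> x \<otimes> inv g \<in> F)}))
      \<le> card S * \<delta> * card {x\<in>R. x \<otimes> inv g \<in> F}"
proof (rule ccontr)
  assume contra: "\<not> ?thesis"
  \<comment> \<open>The finitely many \<open>g\<close> whose translate \<open>F g\<close> meets
    \<open>R\<close>.\<close>
  define T where "T = (\<lambda>(f, x). inv f \<otimes> x) ` (F \<times> R)"
  have T: "finite T" "T \<noteq> {}" "T \<subseteq> carrier G" using F R by (auto simp: T_def)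
  have T_iff: "g \<in> T \<longleftrightarrow> (\<exists>x\<in>R. x \<otimes> inv g \<in> F)" if g: "g \<in> carrier G" for g
  proof
    assume "g \<in> T"
    then obtain f x where fx: "f \<in> F" "x \<in> R" "g = inv f \<otimes> x" by (auto simp: T_def)
    then have "f \<in> carrier G" "x \<in> carrier G" using F R by auto
    then have "x \<otimes> inv g = f" using fx(3) by (simp add: inv_mult_group m_assoc[symmetric])
    then show "\<exists>x\<in>R. x \<otimes> inv g \<in> F" using fx(1,2) by auto
  next
    assume "\<exists>x\<in>R. x \<otimes> inv g \<in> F"
    then obtain x where x: "x \<in> R" "x \<otimes> inv g \<in> F" by auto
    moreover from x have "x \<in> carrier G" using R by auto
    then have "g = inv (x \<otimes> inv g) \<otimes> x" using g by (simp add: inv_mult_group m_assoc)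
    ultimately show "g \<in> T"
      unfolding T_def by (intro image_eqI[of _ _ "(x \<otimes> inv g, x)"]) auto
  qed
  let ?P = "\<lambda>g. {x\<in>R. x \<otimes> inv g \<in> F}"
  let ?C = "\<lambda>s g. {x\<in>R. s \<otimes> x \<in> R \<and> (x \<otimes> inv g \<in> F) \<noteq> (s \<otimes> x \<otimes> inv g \<in> F)}"
  have dc: "(\<Sum>g\<in>T. real (card {x\<in>R. Q x g})) = (\<Sum>x\<in>R. real (card {g\<in>T. Q x g}))" for Q
  proof -
    have "real (card {x\<in>A. p x}) = (\<Sum>x\<in>A. if p x then 1 else 0)" if "finite A" for A and p :: "'a \<Rightarrow> bool"
      using sum.inter_filter[OF that, of "\<lambda>_. 1 :: real" p] by simp
    then show ?thesis using T(1) R(1) by (simp only:) (rule sum.swap)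
  qed
  have P: "(\<Sum>g\<in>T. real (card (?P g))) = real (card R) * card F"
  proof -
    have "card {g\<in>T. x \<otimes> inv g \<in> F} = card F" if x: "x \<in> R" for x
    proof (rule bij_betw_same_card[of "\<lambda>g. x \<otimes> inv g"], rule bij_betw_byWitness[where f' = "\<lambda>f. inv f \<otimes> x"])
      have xc: "x \<in> carrier G" using x R by auto
      show "\<forall>g\<in>{g \<in> T. x \<otimes> inv g \<in> F}. inv (x \<otimes> inv g) \<otimes> x = g"
        using xc T by (auto simp: inv_mult_group m_assoc)
      show "\<forall>f\<in>F. x \<otimes> inv (inv f \<otimes> x) = f"
        using xc F by (auto simp: inv_mult_group m_assoc[symmetric] subset_iff)
      then show "(\<lambda>f. inv f \<otimes> x) ` F \<subseteq> {g \<in> T. x \<otimes> inv g \<in> F}"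
        using x by (auto simp: T_def)
    qed auto
    then show ?thesis by (simp add: dc)
  qed
  have C: "(\<Sum>g\<in>T. real (card (?C s g))) \<le> real (card R) * (\<delta> * card F)" if s: "s \<in> S" for s
  proof -
    have sc: "s \<in> carrier G" using s S by auto
    have "real (card {g\<in>T. s \<otimes> x \<in> R \<and> (x \<otimes> inv g \<in> F) \<noteq> (s \<otimes> x \<otimes> inv g \<in> F)}) \<le> \<delta> * card F"
      if x: "x \<in> R" for x
    proof -
      have xc: "x \<in> carrier G" using x R by auto
      let ?D = "(F - (\<otimes>) s ` F) \<union> ((\<otimes>) s ` F - F)"
      \<comment> \<open>The edge is cut by \<open>F g\<close> iff
        \<open>s \<otimes> x \<otimes> inv g\<close> lies in exactly one of \<open>F\<close> and its
        left translate by \<open>s\<close>; this element determines \<open>g\<close>.\<close>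
      have "card {g\<in>T. s \<otimes> x \<in> R \<and> (x \<otimes> inv g \<in> F) \<noteq> (s \<otimes> x \<otimes> inv g \<in> F)} \<le> card ?D"
      proof (rule card_inj_on_le[where f = "\<lambda>g. s \<otimes> x \<otimes> inv g"])
        show "inj_on (\<lambda>g. s \<otimes> x \<otimes> inv g)
            {g\<in>T. s \<otimes> x \<in> R \<and> (x \<otimes> inv g \<in> F) \<noteq> (s \<otimes> x \<otimes> inv g \<in> F)}"
        proof (rule inj_onI, elim CollectE conjE)
          fix g g' assume "g \<in> T" "g' \<in> T" "s \<otimes> x \<otimes> inv g = s \<otimes> x \<otimes> inv g'"
          then show "g = g'" using T sc xc by (metis inv_closed inv_inv l_cancel m_closed subsetD)
        qed
        show "(\<lambda>g. s \<otimes> x \<otimes> inv g) `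
            {g\<in>T. s \<otimes> x \<in> R \<and> (x \<otimes> inv g \<in> F) \<noteq> (s \<otimes> x \<otimes> inv g \<in> F)} \<subseteq> ?D"
        proof (rule image_subsetI)
          fix g assume g: "g \<in> {g\<in>T. s \<otimes> x \<in> R \<and> (x \<otimes> inv g \<in> F) \<noteq> (s \<otimes> x \<otimes> inv g \<in> F)}"
          then have gc: "g \<in> carrier G" using T by auto
          then have e: "s \<otimes> x \<otimes> inv g = s \<otimes> (x \<otimes> inv g)" using sc xc by (simp add: m_assoc)
          have "x \<otimes> inv g \<in> carrier G" using xc gc by simp
          then have "s \<otimes> (x \<otimes> inv g) = s \<otimes> f \<longleftrightarrow> x \<otimes> inv g = f" if "f \<in> F" for f
            using that F(3) sc by (subst l_cancel) auto
          then have "s \<otimes> x \<otimes> inv g \<in> (\<otimes>) s ` F \<longleftrightarrow> x \<otimes> inv g \<in> F"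
            unfolding e by blast
          then show "s \<otimes> x \<otimes> inv g \<in> ?D" using g by blast
        qed
        show "finite ?D" using F by simp
      qed
      then show ?thesis using inv[OF s] by linarith
    qed
    then show ?thesis unfolding dc using sum_bounded_above[of R _ "\<delta> * card F"] by simp
  qed
  have "(\<Sum>g\<in>T. card S * \<delta> * card (?P g)) < (\<Sum>g\<in>T. \<Sum>s\<in>S. real (card (?C s g)))"
  proof (rule sum_strict_mono[OF T(1,2)])
    fix g assume g: "g \<in> T"
    then have "g \<in> carrier G" using T by auto
    then show "card S * \<delta> * card (?P g) < (\<Sum>s\<in>S. real (card (?C s g)))"
      using contra T_iff[of g] g by (auto simp: not_le)
  qed
  also have "\<dots> = (\<Sum>s\<in>S. \<Sum>g\<in>T. real (card (?C s g)))" by (rule sum.swap)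
  also have "\<dots> \<le> (\<Sum>s\<in>S. real (card R) * (\<delta> * card F))" by (rule sum_mono) (rule C)
  also have "\<dots> = card S * \<delta> * (\<Sum>g\<in>T. real (card (?P g)))" by (simp add: P)
  finally show False by (simp add: sum_distrib_left)
qed

text \<open>\<open>c x\<close> names the translate whose tile contains \<open>x\<close>. Remove one
  good piece and recurse: the bound of \<open>greedy_piece\<close> is proportional to the size of
  the piece, and the pieces add up to \<open>R\<close>.\<close>

lemma greedy_tiling:
  fixes \<delta> :: real
  assumes F: "finite F" "F \<noteq> {}" "F \<subseteq> carrier G" and S: "finite S" "S \<subseteq> carrier G"
    and inv: "\<And>s. s \<in> S \<Longrightarrow> real (card ((F - (\<otimes>) s ` F) \<union> ((\<otimes>) s ` F - F))) \<le> \<delta> * card F"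
    and R: "finite R" "R \<subseteq> carrier G"
  shows "\<exists>c. (\<forall>x\<in>R. c x \<in> carrier G \<and> x \<otimes> inv (c x) \<in> F) \<and>
    (\<Sum>s\<in>S. real (card {x\<in>R. s \<otimes> x \<in> R \<and> c (s \<otimes> x) \<noteq> c x})) \<le> card S * \<delta> * card R"
  using R
proof (induction R rule: finite_psubset_induct)
  case (psubset R)
  show ?case
  proof (cases "R = {}")
    case False
    obtain g where g: "g \<in> carrier G" "{x\<in>R. x \<otimes> inv g \<in> F} \<noteq> {}"
      "(\<Sum>s\<in>S. real (card {x\<in>R. s \<otimes> x \<in> R \<and> (x \<otimes> inv g \<in> F) \<noteq> (s \<otimes> x \<otimes> inv g \<in> F)}))
        \<le> card S * \<delta> * card {x\<in>R. x \<otimes> inv g \<in> F}"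
      using greedy_piece[OF F S inv psubset.hyps(1) False psubset.prems] by blast
    let ?P = "{x\<in>R. x \<otimes> inv g \<in> F}"
    obtain c where c: "\<forall>x\<in>R - ?P. c x \<in> carrier G \<and> x \<otimes> inv (c x) \<in> F"
      "(\<Sum>s\<in>S. real (card {x\<in>R - ?P. s \<otimes> x \<in> R - ?P \<and> c (s \<otimes> x) \<noteq> c x})) \<le> card S * \<delta> * card (R - ?P)"
      using psubset.IH[of "R - ?P"] g(2) psubset.prems by blast
    let ?c = "\<lambda>x. if x \<in> ?P then g else c x"
    \<comment> \<open>An edge inside \<open>R\<close> whose ends get different labels either has
      exactly one end in the piece, or lies in the rest and is cut there; edges within the piece are
      never cut.\<close>
    have "card {x\<in>R. s \<otimes> x \<in> R \<and> ?c (s \<otimes> x) \<noteq> ?c x} \<le>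
        card {x\<in>R. s \<otimes> x \<in> R \<and> (x \<otimes> inv g \<in> F) \<noteq> (s \<otimes> x \<otimes> inv g \<in> F)} +
        card {x\<in>R - ?P. s \<otimes> x \<in> R - ?P \<and> c (s \<otimes> x) \<noteq> c x}" for s
      using psubset.hyps by (intro card_mono[THEN order_trans[OF _ card_Un_le]]) auto
    then have "(\<Sum>s\<in>S. real (card {x\<in>R. s \<otimes> x \<in> R \<and> ?c (s \<otimes> x) \<noteq> ?c x})) \<le>
        (\<Sum>s\<in>S. real (card {x\<in>R. s \<otimes> x \<in> R \<and> (x \<otimes> inv g \<in> F) \<noteq> (s \<otimes> x \<otimes> inv g \<in> F)}) +
        real (card {x\<in>R - ?P. s \<otimes> x \<in> R - ?P \<and> c (s \<otimes> x) \<noteq> c x}))"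
      by (intro sum_mono) (simp flip: of_nat_add)
    also have "\<dots> \<le> card S * \<delta> * card ?P + card S * \<delta> * card (R - ?P)"
      using g(3) c(2) by (simp add: sum.distrib)
    also have "\<dots> = card S * \<delta> * (real (card ?P) + real (card (R - ?P)))"
      by (simp add: algebra_simps)
    also have "real (card ?P) + real (card (R - ?P)) = card R"
      using psubset.hyps(1) card_mono[of R ?P] by (simp add: card_Diff_subset of_nat_diff)
    finally have 1: "(\<Sum>s\<in>S. real (card {x\<in>R. s \<otimes> x \<in> R \<and> ?c (s \<otimes> x) \<noteq> ?c x})) \<le> card S * \<delta> * card R" .
    have 2: "\<forall>x\<in>R. ?c x \<in> carrier G \<and> x \<otimes> inv (?c x) \<in> F" using c(1) g(1) by auto
    show ?thesis by (rule exI[of _ ?c], rule conjI[OF 2 1])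
  qed simp
qed

end

text \<open>Subtraction on naturals is truncated, so one formula covers both cases: nothing is left
  over when \<open>A\<close> fits into \<open>B\<close>.\<close>

lemma exists_partial_matching:
  assumes "finite A" "finite B"
  shows "\<exists>A' f. A' \<subseteq> A \<and> inj_on f A' \<and> f ` A' \<subseteq> B \<and> card (A - A') = card A - card B"
proof (cases "card A \<le> card B")
  case True
  then obtain f where "inj_on f A" "f ` A \<subseteq> B"
    using card_le_inj[OF assms] by blast
  then show ?thesis using True by (intro exI[of _ A] exI[of _ f]) auto
next
  case False
  then obtain A' where A': "A' \<subseteq> A" "card A' = card B" "finite A'"
    by (meson nle_le obtain_subset_with_card_n)
  then obtain f where "bij_betw f A' B" using finite_same_card_bij assms(2) by blast
  then show ?thesis using A'
    by (intro exI[of _ A'] exI[of _ f]) (auto simp: bij_betw_def card_Diff_subset)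
qed

text \<open>Completes the tile matching to a bijection of all points; the values off
  \<open>D\<close> are arbitrary and are paid for as errors.\<close>

lemma extend_injection_to_bij:
  assumes "finite U" "finite V" "card U = card V" "D \<subseteq> U" "inj_on f D" "f ` D \<subseteq> V"
  shows "\<exists>b. bij_betw b U V \<and> (\<forall>x\<in>D. b x = f x)"
proof -
  have "card (U - D) = card (V - f ` D)"
    using assms by (simp add: card_Diff_subset card_image finite_subset)
  then obtain h where h: "bij_betw h (U - D) (V - f ` D)"
    using finite_same_card_bij assms by (metis finite_Diff)
  let ?b = "\<lambda>x. if x \<in> D then f x else h x"
  have "bij_betw ?b D (f ` D)" using assms(5) by (auto simp: bij_betw_def inj_on_def)
  moreover have "bij_betw ?b (U - D) (V - f ` D)"
    using h by (rule bij_betw_cong[THEN iffD1, rotated]) auto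
  ultimately have "bij_betw ?b (D \<union> (U - D)) (f ` D \<union> (V - f ` D))"
    by (rule bij_betw_combine) auto
  moreover have "D \<union> (U - D) = U" "f ` D \<union> (V - f ` D) = V" using assms by auto
  ultimately show ?thesis by (intro exI[of _ ?b]) auto
qed

section \<open>Tile shapes and the matching of two tiled sets\<close>

context group begin

text \<open>The tile labelled \<open>g\<close>, carried back into \<open>F\<close> by right
  multiplication with \<open>inv g\<close>.\<close>

definition shape :: "'a set \<Rightarrow> ('a \<Rightarrow> 'a) \<Rightarrow> 'a \<Rightarrow> 'a set" where
  "shape Y c g = {x \<otimes> inv g |x. x \<in> Y \<and> c x = g}"

definition tile_count :: "'a set \<Rightarrow> ('a \<Rightarrow> 'a) \<Rightarrow> 'a set \<Rightarrow> nat" where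
  "tile_count Y c T = card {g \<in> c ` Y. shape Y c g = T}"

text \<open>A pair \<open>(x, i)\<close> is the point \<open>x\<close> in copy number
  \<open>i\<close>. The map \<open>b\<close> intertwines left multiplication by \<open>s\<close> at
  this point: \<open>s\<close> moves the point and its image, each inside its own copy.\<close>

definition commute_at :: "'a set \<Rightarrow> ('a \<times> nat \<Rightarrow> 'a \<times> nat) \<Rightarrow> 'a \<Rightarrow> 'a \<times> nat \<Rightarrow> bool" where
  "commute_at Y b s p \<longleftrightarrow> s \<otimes> fst p \<in> Y \<and> b (s \<otimes> fst p, snd p) = (s \<otimes> fst (b p), snd (b p))"

text \<open>Since \<open>Y\<close> and \<open>Y'\<close> may differ in size, \<open>card Y'\<close> copies of \<open>Y\<close> are compared with
  \<open>card Y\<close> copies of \<open>Y'\<close>.\<close>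
definition close_sets :: "'a set \<Rightarrow> real \<Rightarrow> 'a set \<Rightarrow> 'a set \<Rightarrow> bool" where
  "close_sets E \<epsilon> Y Y' \<longleftrightarrow> (\<exists>b. bij_betw b (Y \<times> {..<card Y'}) (Y' \<times> {..<card Y}) \<and>
     (\<forall>s\<in>E. real (card {p \<in> Y \<times> {..<card Y'}. \<not> commute_at Y b s p}) \<le> \<epsilon> * card Y * card Y'))"

text \<open>Each of the \<open>2 ^ card F\<close> possible shapes leaves at most
  \<open>\<eta> * card Y * card Y'\<close> tile copies unmatched, each with at most
  \<open>card F\<close> points; this is the last error term. At a point of a matched tile the
  commutation can fail only if \<open>s\<close> moves it out of \<open>Y\<close> or into another
  tile, which gives the first two terms.\<close>

lemma match_tilings:
  fixes \<eta> :: real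
  assumes F: "finite F" "F \<subseteq> carrier G"
    and Y: "finite Y" "Y \<noteq> {}" "Y \<subseteq> carrier G" and Y': "finite Y'" "Y' \<noteq> {}" "Y' \<subseteq> carrier G"
    and c: "\<And>x. x \<in> Y \<Longrightarrow> c x \<in> carrier G \<and> x \<otimes> inv (c x) \<in> F"
    and c': "\<And>x. x \<in> Y' \<Longrightarrow> c' x \<in> carrier G \<and> x \<otimes> inv (c' x) \<in> F"
    and freq: "\<And>T. T \<subseteq> F \<Longrightarrow>
      real (tile_count Y c T) / card Y - real (tile_count Y' c' T) / card Y' \<le> \<eta>"
    and eta: "\<eta> \<ge> 0"
  shows "\<exists>b. bij_betw b (Y \<times> {..<card Y'}) (Y' \<times> {..<card Y}) \<and>
    (\<forall>s\<in>carrier G. real (card {p \<in> Y \<times> {..<card Y'}. \<not> commute_at Y b s p}) \<le>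
       real (card {x\<in>Y. s \<otimes> x \<notin> Y}) * card Y' +
       real (card {x\<in>Y. s \<otimes> x \<in> Y \<and> c (s \<otimes> x) \<noteq> c x}) * card Y' +
       2 ^ card F * card F * \<eta> * card Y * card Y')"
proof -
  let ?U = "Y \<times> {..<card Y'}" and ?V = "Y' \<times> {..<card Y}"
  \<comment> \<open>Tile copies of shape \<open>T\<close>. With \<open>card Y'\<close> copies of
    \<open>Y\<close> and \<open>card Y\<close> copies of \<open>Y'\<close>, comparing their numbers
    amounts to comparing frequencies.\<close>
  define A where "A T = {g \<in> c ` Y. shape Y c g = T} \<times> {..<card Y'}" for T
  define B where "B T = {g \<in> c' ` Y'. shape Y' c' g = T} \<times> {..<card Y}" for T
  have finA: "finite (A T)" and finB: "finite (B T)" for T using Y Y' by (auto simp: A_def B_def)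
  have cardY: "real (card Y) > 0" "real (card Y') > 0" using Y Y' by (auto simp: card_gt_0_iff)
  have "\<forall>T. \<exists>A' f. A' \<subseteq> A T \<and> inj_on f A' \<and> f ` A' \<subseteq> B T \<and> card (A T - A') = card (A T) - card (B T)"
    using exists_partial_matching[OF finA finB] by blast
  then obtain A' f where Af: "\<And>T. A' T \<subseteq> A T" "\<And>T. inj_on (f T) (A' T)" "\<And>T. f T ` A' T \<subseteq> B T"
    "\<And>T. card (A T - A' T) = card (A T) - card (B T)" by metis
  define D where "D = {p \<in> ?U. (c (fst p), snd p) \<in> A' (shape Y c (c (fst p)))}"
  define t where "t p = f (shape Y c (c (fst p))) (c (fst p), snd p)" for p
  \<comment> \<open>The point keeps its position in the tile while the label changes to that of the
    matched tile: a right translation, which commutes with left multiplication.\<close>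
  define h where "h p = (fst p \<otimes> inv (c (fst p)) \<otimes> fst (t p), snd (t p))" for p
  have Yc: "x \<in> carrier G" if "x \<in> Y" for x using that Y by auto
  have tD: "fst (t p) \<in> carrier G" "fst (h p) \<in> Y'" "snd (h p) < card Y" "c' (fst (h p)) = fst (t p)"
    "shape Y' c' (fst (t p)) = shape Y c (c (fst p))" if "p \<in> D" for p
  proof -
    have p: "fst p \<in> Y" and "t p \<in> B (shape Y c (c (fst p)))"
      using that Af(3) by (auto simp: D_def t_def)
    then have t: "fst (t p) \<in> c' ` Y'" "shape Y' c' (fst (t p)) = shape Y c (c (fst p))" "snd (t p) < card Y"
      by (simp_all add: B_def mem_Times_iff)
    then show "fst (t p) \<in> carrier G" "snd (h p) < card Y"
      "shape Y' c' (fst (t p)) = shape Y c (c (fst p))" using c' by (auto simp: h_def)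
    have "fst p \<otimes> inv (c (fst p)) \<in> shape Y' c' (fst (t p))"
      unfolding t(2) using p by (auto simp: shape_def)
    then obtain y where y: "y \<in> Y'" "c' y = fst (t p)" "fst p \<otimes> inv (c (fst p)) = y \<otimes> inv (fst (t p))"
      by (auto simp: shape_def)
    then have "fst (h p) = y"
      using \<open>fst (t p) \<in> carrier G\<close> Y' by (auto simp: h_def m_assoc subset_iff)
    then show "fst (h p) \<in> Y'" "c' (fst (h p)) = fst (t p)" using y by auto
  qed
  \<comment> \<open>The image of \<open>p\<close> reveals the matched tile copy, hence its shape,
    hence by injectivity of \<open>f\<close> the tile copy of \<open>p\<close>; the position in the
    tile then recovers \<open>p\<close>.\<close>
  have inj: "inj_on h D"
  proof (rule inj_onI)
    fix p q assume p: "p \<in> D" and q: "q \<in> D" and e: "h p = h q"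
    then have "fst (t p) = fst (t q)" using tD(4) by metis
    moreover have "snd (t p) = snd (t q)" using e by (simp add: h_def)
    ultimately have t: "t p = t q" by (simp add: prod_eq_iff)
    then have sh: "shape Y c (c (fst p)) = shape Y c (c (fst q))" using tD(5) p q by metis
    have "(c (fst p), snd p) = (c (fst q), snd q)"
      using inj_onD[OF Af(2)] t p q sh unfolding t_def D_def by auto
    moreover from this have "fst p = fst q"
      using e t p q c Yc tD(1) unfolding h_def D_def by auto
    ultimately show "p = q" by (simp add: prod_eq_iff)
  qed
  have D_sub: "D \<subseteq> ?U" by (auto simp: D_def)
  have h_sub: "h ` D \<subseteq> ?V" using tD(2,3) by (intro image_subsetI) (simp add: mem_Times_iff)
  have "card ?U = card ?V" by (simp add: card_cartesian_product mult.commute)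
  then obtain b where b: "bij_betw b ?U ?V" "\<forall>x\<in>D. b x = h x"
    using extend_injection_to_bij[OF _ _ _ D_sub inj h_sub] Y(1) Y'(1) by auto
  have AA: "real (card (A T - A' T)) \<le> \<eta> * card Y * card Y'" if T: "T \<subseteq> F" for T
  proof -
    have "real (tile_count Y c T) * card Y' - real (tile_count Y' c' T) * card Y
        = (real (tile_count Y c T) / card Y - real (tile_count Y' c' T) / card Y') * (card Y * card Y')"
      using cardY by (simp add: field_simps)
    also have "\<dots> \<le> \<eta> * (card Y * card Y')" by (rule mult_right_mono[OF freq[OF T]]) simp
    finally have "real (card (A T)) - real (card (B T)) \<le> \<eta> * card Y * card Y'"
      by (simp add: A_def B_def tile_count_def mult.assoc card_cartesian_product)
    then show ?thesis using Af(4)[of T] eta by (cases "card (A T) \<le> card (B T)") (auto simp: of_nat_diff)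
  qed
  have UD: "real (card (?U - D)) \<le> 2 ^ card F * card F * \<eta> * card Y * card Y'"
  proof -
    let ?W = "\<Union>T\<in>Pow F. (A T - A' T) \<times> F"
    have finW: "finite ?W" using F finA by auto
    \<comment> \<open>An unmatched point is encoded by its tile copy and its position in
      \<open>F\<close>.\<close>
    have "card (?U - D) \<le> card ?W"
    proof (rule card_inj_on_le[where f = "\<lambda>p. ((c (fst p), snd p), fst p \<otimes> inv (c (fst p)))"])
      show "inj_on (\<lambda>p. ((c (fst p), snd p), fst p \<otimes> inv (c (fst p)))) (?U - D)"
        using c Yc by (intro inj_onI) auto
      have "shape Y c g \<subseteq> F" for g using c by (auto simp: shape_def)
      then show "(\<lambda>p. ((c (fst p), snd p), fst p \<otimes> inv (c (fst p)))) ` (?U - D) \<subseteq> ?W"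
        using c by (auto simp: D_def A_def)
    qed (rule finW)
    also have "\<dots> \<le> (\<Sum>T\<in>Pow F. card ((A T - A' T) \<times> F))"
      using F by (intro card_UN_le) auto
    finally have "real (card (?U - D)) \<le> (\<Sum>T\<in>Pow F. real (card (A T - A' T)) * card F)"
      by (simp add: card_cartesian_product flip: of_nat_sum of_nat_mult)
    also have "\<dots> \<le> (\<Sum>T\<in>Pow F. (\<eta> * card Y * card Y') * card F)"
      using AA by (intro sum_mono mult_right_mono) auto
    finally show ?thesis using F by (simp add: card_Pow mult_ac)
  qed
  have "real (card {p \<in> ?U. \<not> commute_at Y b s p}) \<le>
       real (card {x\<in>Y. s \<otimes> x \<notin> Y}) * card Y' +
       real (card {x\<in>Y. s \<otimes> x \<in> Y \<and> c (s \<otimes> x) \<noteq> c x}) * card Y' +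
       2 ^ card F * card F * \<eta> * card Y * card Y'" if s: "s \<in> carrier G" for s
  proof -
    let ?K = "{x\<in>Y. s \<otimes> x \<notin> Y}" and ?M = "{x\<in>Y. s \<otimes> x \<in> Y \<and> c (s \<otimes> x) \<noteq> c x}"
    have sub: "{p \<in> ?U. \<not> commute_at Y b s p} \<subseteq> ?K \<times> {..<card Y'} \<union> ?M \<times> {..<card Y'} \<union> (?U - D)"
    proof safe
      fix x i assume x: "x \<in> Y" "i < card Y'" "(x, i) \<in> D" "s \<otimes> x \<in> Y" "c (s \<otimes> x) = c x"
        and n: "\<not> commute_at Y b s (x, i)"
      have D: "(s \<otimes> x, i) \<in> D" using x by (auto simp: D_def)
      have "t (s \<otimes> x, i) = t (x, i)" using x by (simp add: t_def)
      then have "h (s \<otimes> x, i) = (s \<otimes> fst (h (x, i)), snd (h (x, i)))"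
        using x s c Yc tD(1)[OF x(3)] by (simp add: h_def m_assoc)
      then have "commute_at Y b s (x, i)" using b(2) D x by (simp add: commute_at_def)
      then show False using n by simp
    qed
    have "finite (?K \<times> {..<card Y'} \<union> ?M \<times> {..<card Y'} \<union> (?U - D))" using Y Y' by simp
    then have "card {p \<in> ?U. \<not> commute_at Y b s p} \<le> card (?K \<times> {..<card Y'}) + card (?M \<times> {..<card Y'}) + card (?U - D)"
      using card_mono[OF _ sub] card_Un_le[of "?K \<times> {..<card Y'} \<union> ?M \<times> {..<card Y'}" "?U - D"]
        card_Un_le[of "?K \<times> {..<card Y'}" "?M \<times> {..<card Y'}"] by linarith
    then have "real (card {p \<in> ?U. \<not> commute_at Y b s p}) \<le>
        real (card ?K) * card Y' + real (card ?M) * card Y' + real (card (?U - D))"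
      by (simp add: card_cartesian_product flip: of_nat_mult of_nat_add)
    then show ?thesis using UD by linarith
  qed
  then show ?thesis using b(1) by blast
qed

end

subsection \<open>Towers of Folner sets\<close>

context group begin

lemma tile_count_le_card: "finite Y \<Longrightarrow> tile_count Y c T \<le> card Y"
  unfolding tile_count_def
  by (rule order_trans[OF card_mono card_image_le]) auto

text \<open>A single \<open>F\<close>, depending only on \<open>E\<close> and
  \<open>\<epsilon>\<close>, tiles all the sets \<open>Z m\<close>, so their frequency vectors can
  be compared. Each third of \<open>\<epsilon>\<close> pays for one error term of
  \<open>match_tilings\<close>: points leaving \<open>Z m\<close>, cut edges, unmatched
  tiles.\<close>

lemma close_subfamily:
  fixes Z :: "nat \<Rightarrow> 'a set" and \<epsilon> :: real
  assumes am: "amenable_group G" and E: "finite E" "E \<subseteq> carrier G" and eps: "\<epsilon> > 0"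
    and N: "infinite N" and Z: "\<And>m. finite (Z m) \<and> Z m \<noteq> {} \<and> Z m \<subseteq> carrier G"
    and bd: "\<And>m s. m \<in> N \<Longrightarrow> s \<in> E \<Longrightarrow> real (card {x\<in>Z m. s \<otimes> x \<notin> Z m}) \<le> \<epsilon> / 3 * card (Z m)"
  shows "\<exists>N'\<subseteq>N. infinite N' \<and> (\<forall>m\<in>N'. \<forall>m'\<in>N'. close_sets E \<epsilon> (Z m) (Z m'))"
proof -
  \<comment> \<open>The tiling bounds the cut edges, summed over \<open>E\<close>, by
    \<open>card E * \<delta>\<close> times the size of the set; the added 1 keeps the quotient
    meaningful for empty \<open>E\<close>.\<close>
  define \<delta> where "\<delta> = \<epsilon> / 3 / (card E + 1)"
  have "\<delta> > 0" using eps by (simp add: \<delta>_def)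
  then obtain F where F: "finite F" "F \<noteq> {}" "F \<subseteq> carrier G"
    and inv: "\<And>s. s \<in> E \<Longrightarrow> real (card ((F - (\<otimes>) s ` F) \<union> ((\<otimes>) s ` F - F))) \<le> \<delta> * card F"
    using am E unfolding amenable_group_def by (metis less_imp_le)
  have "\<exists>c. (\<forall>x\<in>Z m. c x \<in> carrier G \<and> x \<otimes> inv (c x) \<in> F) \<and>
    (\<Sum>s\<in>E. real (card {x\<in>Z m. s \<otimes> x \<in> Z m \<and> c (s \<otimes> x) \<noteq> c x})) \<le> card E * \<delta> * card (Z m)" for m
    using greedy_tiling[OF F E inv] Z[of m] by blast
  from choice[OF allI[OF this]] obtain c where "\<forall>m. (\<forall>x\<in>Z m. c m x \<in> carrier G \<and> x \<otimes> inv (c m x) \<in> F) \<and>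
    (\<Sum>s\<in>E. real (card {x\<in>Z m. s \<otimes> x \<in> Z m \<and> c m (s \<otimes> x) \<noteq> c m x})) \<le> card E * \<delta> * card (Z m)" ..
  then have c: "\<And>m x. x \<in> Z m \<Longrightarrow> c m x \<in> carrier G \<and> x \<otimes> inv (c m x) \<in> F"
    and cut: "\<And>m. (\<Sum>s\<in>E. real (card {x\<in>Z m. s \<otimes> x \<in> Z m \<and> c m (s \<otimes> x) \<noteq> c m x})) \<le> card E * \<delta> * card (Z m)"
    by blast+
  have cut1: "real (card {x\<in>Z m. s \<otimes> x \<in> Z m \<and> c m (s \<otimes> x) \<noteq> c m x}) \<le> \<epsilon> / 3 * card (Z m)" if "s \<in> E" for m s
  proof -
    have "real (card {x\<in>Z m. s \<otimes> x \<in> Z m \<and> c m (s \<otimes> x) \<noteq> c m x}) \<le>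
        (\<Sum>s\<in>E. real (card {x\<in>Z m. s \<otimes> x \<in> Z m \<and> c m (s \<otimes> x) \<noteq> c m x}))"
      using that E by (intro member_le_sum) auto
    also have "\<dots> \<le> card E * \<delta> * card (Z m)" by (rule cut)
    also have "\<dots> \<le> \<epsilon> / 3 * card (Z m)"
      using eps by (intro mult_right_mono) (auto simp: \<delta>_def divide_simps)
    finally show ?thesis .
  qed
  define \<eta> where "\<eta> = \<epsilon> / 3 / (2 ^ card F * card F)"
  have "card F > 0" using F by (simp add: card_gt_0_iff)
  then have eta: "\<eta> > 0" using eps by (simp add: \<eta>_def)
  \<comment> \<open>Frequencies rounded down to multiples of \<open>\<eta>\<close>: there are
    finitely many codes, and equal codes mean frequencies within \<open>\<eta>\<close>.\<close>
  define code where "code m = (\<lambda>T\<in>Pow F. \<lfloor>real (tile_count (Z m) (c m) T) / card (Z m) / \<eta>\<rfloor>)" for m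
  have "code m \<in> Pow F \<rightarrow>\<^sub>E {0..\<lfloor>1 / \<eta>\<rfloor>}" for m
  proof -
    have "real (tile_count (Z m) (c m) T) / card (Z m) \<le> 1" for T
      using tile_count_le_card[of "Z m" "c m" T] Z[of m] by (simp add: divide_simps card_gt_0_iff)
    then have "real (tile_count (Z m) (c m) T) / card (Z m) / \<eta> \<le> 1 / \<eta>" for T
      using eta by (intro divide_right_mono) auto
    then show ?thesis using eta by (auto simp: code_def intro!: floor_mono)
  qed
  then have "finite (code ` N)"
    by (intro finite_subset[OF _ finite_PiE[of "Pow F" "\<lambda>_. {0..\<lfloor>1 / \<eta>\<rfloor>}"]]) (use F in auto)
  then obtain m0 where m0: "infinite {m\<in>N. code m = code m0}"
    using pigeonhole_infinite[OF N] by blast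
  have "close_sets E \<epsilon> (Z m) (Z m')" if m: "m \<in> N" "m' \<in> N" "code m = code m'" for m m'
  proof -
    have freq: "real (tile_count (Z m) (c m) T) / card (Z m) - real (tile_count (Z m') (c m') T) / card (Z m') \<le> \<eta>"
      if T: "T \<subseteq> F" for T
    proof -
      define x y where "x = real (tile_count (Z m) (c m) T) / card (Z m)"
        and "y = real (tile_count (Z m') (c m') T) / card (Z m')"
      have "\<lfloor>x / \<eta>\<rfloor> = \<lfloor>y / \<eta>\<rfloor>"
        using fun_cong[OF m(3), of T] T by (simp add: code_def x_def y_def)
      then have "x / \<eta> - y / \<eta> \<le> 1" by linarith
      then show ?thesis using eta unfolding x_def[symmetric] y_def[symmetric]
        by (simp add: divide_simps flip: diff_divide_distrib)
    qed
    obtain b where b: "bij_betw b (Z m \<times> {..<card (Z m')}) (Z m' \<times> {..<card (Z m)})"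
      "\<And>s. s \<in> carrier G \<Longrightarrow> real (card {p \<in> Z m \<times> {..<card (Z m')}. \<not> commute_at (Z m) b s p}) \<le>
       real (card {x\<in>Z m. s \<otimes> x \<notin> Z m}) * card (Z m') +
       real (card {x\<in>Z m. s \<otimes> x \<in> Z m \<and> c m (s \<otimes> x) \<noteq> c m x}) * card (Z m') +
       2 ^ card F * card F * \<eta> * card (Z m) * card (Z m')"
      using match_tilings[OF F(1,3) _ _ _ _ _ _ c c freq less_imp_le[OF eta]] Z[of m] Z[of m'] by blast
    have "real (card {p \<in> Z m \<times> {..<card (Z m')}. \<not> commute_at (Z m) b s p}) \<le> \<epsilon> * card (Z m) * card (Z m')"
      if s: "s \<in> E" for s
    proof -
      have e: "2 ^ card F * card F * \<eta> = \<epsilon> / 3" using \<open>card F > 0\<close> by (simp add: \<eta>_def)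
      have "s \<in> carrier G" using s E by auto
      from b(2)[OF this, unfolded e] have "real (card {p \<in> Z m \<times> {..<card (Z m')}. \<not> commute_at (Z m) b s p}) \<le>
          (\<epsilon> / 3 * card (Z m)) * card (Z m') + (\<epsilon> / 3 * card (Z m)) * card (Z m') + \<epsilon> / 3 * card (Z m) * card (Z m')"
        using mult_right_mono[OF bd[OF m(1) s], of "real (card (Z m'))"]
          mult_right_mono[OF cut1[OF s, of m], of "real (card (Z m'))"] by linarith
      then show ?thesis by linarith
    qed
    then show ?thesis using b(1) unfolding close_sets_def by blast
  qed
  then show ?thesis using m0 by (intro exI[of _ "{m\<in>N. code m = code m0}"]) auto
qed

text \<open>The sets grow by squaring rather than by one generator at a time, since the product rule
  of \<open>generate\<close> multiplies two arbitrary generated elements. The unit in each set makes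
  the sequence increasing.\<close>

lemma fin_gen_exhaustion:
  assumes "fin_gen_group G"
  shows "\<exists>E :: nat \<Rightarrow> 'a set. (\<forall>n. finite (E n) \<and> E n \<subseteq> carrier G) \<and> incseq E \<and> (\<Union>n. E n) = carrier G"
proof -
  obtain S where S: "finite S" "S \<subseteq> carrier G" "generate G S = carrier G"
    using assms by (auto simp: fin_gen_group_def)
  define E where "E n = ((\<lambda>A. (\<lambda>(x, y). x \<otimes> y) ` (A \<times> A)) ^^ n) ({\<one>} \<union> S \<union> (\<lambda>x. inv x) ` S)" for n
  have E_Suc: "E (Suc n) = (\<lambda>(x, y). x \<otimes> y) ` (E n \<times> E n)" for n by (simp add: E_def)
  have one_E: "\<one> \<in> E n" and fin: "finite (E n)" and sub: "E n \<subseteq> carrier G" for n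
  proof (induction n)
    case 0
    { case 1 show ?case by (simp add: E_def) }
    { case 2 show ?case using S by (simp add: E_def) }
    { case 3 show ?case using S by (auto simp: E_def) }
  next
    case (Suc n)
    { case 1 show ?case using Suc.IH(1) unfolding E_Suc by (intro image_eqI[of _ _ "(\<one>, \<one>)"]) auto }
    { case 2 show ?case using Suc.IH(2) unfolding E_Suc by simp }
    { case 3 show ?case using Suc.IH(3) unfolding E_Suc by auto }
  qed
  have inc: "incseq E"
  proof (rule incseq_SucI)
    show "E n \<le> E (Suc n)" for n
    proof
      fix x assume "x \<in> E n"
      then show "x \<in> E (Suc n)"
        using one_E[of n] sub[of n] unfolding E_Suc by (intro image_eqI[of _ _ "(\<one>, x)"]) auto
    qed
  qed
  have "x \<in> (\<Union>n. E n)" if "x \<in> generate G S" for x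
    using that
  proof (induction rule: generate.induct)
    case one
    show ?case by (rule UN_I[of 0]) (simp_all add: one_E)
  next
    case (incl h)
    then show ?case by (intro UN_I[of 0]) (simp_all add: E_def)
  next
    case (inv h)
    then show ?case by (intro UN_I[of 0]) (simp_all add: E_def)
  next
    case (eng h1 h2)
    then obtain n1 n2 where "h1 \<in> E n1" "h2 \<in> E n2" by auto
    then have "h1 \<in> E (max n1 n2)" "h2 \<in> E (max n1 n2)"
      using incseqD[OF inc, of n1 "max n1 n2"] incseqD[OF inc, of n2 "max n1 n2"] by auto
    then have "h1 \<otimes> h2 \<in> E (Suc (max n1 n2))"
      unfolding E_Suc by (intro image_eqI[of _ _ "(h1, h2)"]) auto
    then show ?case by (intro UN_I[of "Suc (max n1 n2)"]) simp_all
  qed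
  then have "(\<Union>n. E n) = carrier G" using S(3) by (intro equalityI UN_least sub subsetI) simp_all
  then show ?thesis using fin sub inc by blast
qed

text \<open>Nested infinite index sets \<open>N n\<close> are chosen with closeness at precision
  \<open>1 / 2 ^ n\<close> inside \<open>N n\<close>. Since \<open>N (Suc n)\<close> is contained in
  \<open>N n\<close>, the chosen indices \<open>m n\<close> and \<open>m (Suc n)\<close> both lie in
  \<open>N n\<close>, so consecutive sets are close.\<close>

lemma folner_chain:
  assumes am: "amenable_group G" and E: "\<And>n. finite (E n) \<and> E n \<subseteq> carrier G" and inc: "incseq E"
  shows "\<exists>Y :: nat \<Rightarrow> 'a set. \<forall>n. finite (Y n) \<and> Y n \<noteq> {} \<and> Y n \<subseteq> carrier G \<and>
    (\<forall>s\<in>E n. real (card {x\<in>Y n. s \<otimes> x \<notin> Y n}) \<le> 1 / 2 ^ n * card (Y n)) \<and>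
    close_sets (E n) (1 / 2 ^ n) (Y n) (Y (Suc n))"
proof -
  have "\<exists>Z. finite Z \<and> Z \<noteq> {} \<and> Z \<subseteq> carrier G \<and>
    (\<forall>s\<in>E m. real (card {x\<in>Z. s \<otimes> x \<notin> Z}) \<le> 1 / 2 ^ m / 3 * card Z)" for m
  proof -
    have "(0::real) < 1 / 2 ^ m / 3" by simp
    then obtain Z where Z: "finite Z" "Z \<noteq> {}" "Z \<subseteq> carrier G"
      "\<forall>s\<in>E m. real (card ((Z - (\<otimes>) s ` Z) \<union> ((\<otimes>) s ` Z - Z))) < 1 / 2 ^ m / 3 * card Z"
      using am E[of m] unfolding amenable_group_def by metis
    have "real (card {x\<in>Z. s \<otimes> x \<notin> Z}) \<le> 1 / 2 ^ m / 3 * card Z" if s: "s \<in> E m" for s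
    proof -
      have "s \<in> carrier G" using s E by auto
      then have "inj_on ((\<otimes>) s) {x\<in>Z. s \<otimes> x \<notin> Z}" using Z(3)
        by (intro inj_on_subset[OF inj_on_cmult]) auto
      then have "card {x\<in>Z. s \<otimes> x \<notin> Z} \<le> card ((Z - (\<otimes>) s ` Z) \<union> ((\<otimes>) s ` Z - Z))"
        using Z(1) by (intro card_inj_on_le) auto
      then show ?thesis using Z(4) s by force
    qed
    then show ?thesis using Z by blast
  qed
  from choice[OF allI[OF this]] obtain Z where "\<forall>m. finite (Z m) \<and> Z m \<noteq> {} \<and> Z m \<subseteq> carrier G \<and>
    (\<forall>s\<in>E m. real (card {x\<in>Z m. s \<otimes> x \<notin> Z m}) \<le> 1 / 2 ^ m / 3 * card (Z m))" ..
  then have Z: "\<And>m. finite (Z m) \<and> Z m \<noteq> {} \<and> Z m \<subseteq> carrier G"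
    and bd: "\<And>m s. s \<in> E m \<Longrightarrow> real (card {x\<in>Z m. s \<otimes> x \<notin> Z m}) \<le> 1 / 2 ^ m / 3 * card (Z m)" by blast+
  have mono: "(1::real) / 2 ^ m \<le> 1 / 2 ^ n" if "n \<le> m" for m n :: nat
    using that by (simp add: divide_simps power_increasing)
  have bd': "real (card {x\<in>Z m. s \<otimes> x \<notin> Z m}) \<le> 1 / 2 ^ n / 3 * card (Z m)" if "n \<le> m" "s \<in> E n" for n m s
  proof -
    have "s \<in> E m" using that incseqD[OF inc that(1)] by auto
    from bd[OF this] show ?thesis
      using mult_right_mono[OF divide_right_mono[OF mono[OF that(1)], of 3], of "real (card (Z m))"] by simp
  qed
  \<comment> \<open>Indices from \<open>n\<close> on guarantee that the boundary of
    \<open>Z m\<close> is small for every element of \<open>E n\<close>.\<close>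
  let ?P = "\<lambda>n N. infinite N \<and> N \<subseteq> {n..} \<and>
    (\<forall>m\<in>N. \<forall>m'\<in>N. close_sets (E n) (1 / 2 ^ n) (Z m) (Z m'))"
  have step: "\<exists>N'. ?P n N' \<and> N' \<subseteq> N" if N: "infinite N" for n N
  proof -
    have "infinite (N \<inter> {n..})"
    proof
      assume "finite (N \<inter> {n..})"
      moreover have "N \<subseteq> (N \<inter> {n..}) \<union> {..<n}" by auto
      ultimately show False using N by (meson finite_Un finite_lessThan finite_subset)
    qed
    then have "\<exists>N'\<subseteq>N \<inter> {n..}. infinite N' \<and>
        (\<forall>m\<in>N'. \<forall>m'\<in>N'. close_sets (E n) (1 / 2 ^ n) (Z m) (Z m'))"
      using E Z bd' by (intro close_subfamily[OF am]) auto
    then show ?thesis by blast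
  qed
  have "\<exists>f. \<forall>n. ?P n (f n) \<and> f (Suc n) \<subseteq> f n"
  proof (rule dependent_nat_choice)
    show "\<exists>N. ?P 0 N" using step[of UNIV 0] by auto
    show "\<exists>N'. ?P (Suc n) N' \<and> N' \<subseteq> N" if "?P n N" for n N using step[of N "Suc n"] that by blast
  qed
  then obtain N where "\<forall>n. ?P n (N n) \<and> N (Suc n) \<subseteq> N n" ..
  then have N: "?P n (N n)" "N (Suc n) \<subseteq> N n" for n by simp_all
  have "\<exists>m. m \<in> N n" for n
  proof -
    have "N n \<noteq> {}" using N(1)[of n] by (intro infinite_imp_nonempty) simp
    then show ?thesis by blast
  qed
  from choice[OF allI[OF this]] obtain m where m: "\<forall>n. m n \<in> N n" ..
  show ?thesis
  proof (intro exI[of _ "\<lambda>n. Z (m n)"] allI conjI ballI)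
    fix n
    show "close_sets (E n) (1 / 2 ^ n) (Z (m n)) (Z (m (Suc n)))"
      using N(1)[of n] N(2)[of n] m by blast
    have "n \<le> m n" using N(1)[of n] m by auto
    then show "real (card {x\<in>Z (m n). s \<otimes> x \<notin> Z (m n)}) \<le> 1 / 2 ^ n * card (Z (m n))" if "s \<in> E n" for s
      using bd'[OF _ that, of "m n"] by simp
  qed (use Z in auto)
qed

end

text \<open>A point \<open>i < d n\<close> is a group element \<open>L n i\<close> in the copy \<open>C n i\<close> of the \<open>n\<close>-th Folner set.\<close>
locale coordinate_tower = group G + dim_chain d for G (structure) and d +
  fixes L :: "nat \<Rightarrow> nat \<Rightarrow> 'a" and C :: "nat \<Rightarrow> nat \<Rightarrow> nat"
  assumes L_carrier: "i < d n \<Longrightarrow> L n i \<in> carrier G"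
    and LC_inj: "i < d n \<Longrightarrow> j < d n \<Longrightarrow> L n i = L n j \<Longrightarrow> C n i = C n j \<Longrightarrow> i = j"
begin

definition moves :: "nat \<Rightarrow> 'a \<Rightarrow> nat \<Rightarrow> nat \<Rightarrow> bool" where
  "moves n s i j \<longleftrightarrow> C n i = C n j \<and> L n i = s \<otimes> L n j"

definition inner :: "nat \<Rightarrow> 'a \<Rightarrow> nat \<Rightarrow> bool" where
  "inner n s j \<longleftrightarrow> (\<exists>i<d n. moves n s i j)"

text \<open>At level \<open>n + 1\<close>, \<open>j div d n\<close> is the diagonal block of the
  connecting map and \<open>j mod d n\<close> the point of level \<open>n\<close> repeated there.
  Moving by \<open>s\<close> inside the block and moving by \<open>s\<close> in the next Folner set
  must lead to the same index.\<close>

definition coherent :: "nat \<Rightarrow> 'a \<Rightarrow> nat \<Rightarrow> bool" where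
  "coherent n s j \<longleftrightarrow> (\<exists>i<d (Suc n). i div d n = j div d n \<and>
     moves n s (i mod d n) (j mod d n) \<and> moves (Suc n) s i j)"

end

text \<open>Inner points serve multiplicativity and injectivity, coherent points the Cauchy
  property. The start \<open>N\<close> depends on \<open>s\<close>; finitely many \<open>s\<close>
  are combined later.\<close>

locale folner_tower = coordinate_tower +
  assumes mostly_inner: "s \<in> carrier G \<Longrightarrow>
      \<exists>N. \<forall>n\<ge>N. real (card {j. j < d n \<and> \<not> inner n s j}) \<le> d n / 2 ^ n"
    and mostly_coherent: "s \<in> carrier G \<Longrightarrow>
      \<exists>N. \<forall>n\<ge>N. real (card {j. j < d (Suc n) \<and> \<not> coherent n s j}) \<le> d (Suc n) / 2 ^ n"

text \<open>\<open>k (Suc n)\<close> will be the size of level \<open>n\<close>, so \<open>i\<close>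
  splits into a block number and a point \<open>(x, c)\<close> of that level. The bijection
  \<open>b n\<close> acts on \<open>x\<close> and the block number; its copy number \<open>q\<close>
  and the old copy number \<open>c\<close> become the two digits of the new copy number to base
  \<open>k n\<close>.\<close>

primrec stack_coords :: "(nat \<Rightarrow> 'a \<times> nat \<Rightarrow> 'a \<times> nat) \<Rightarrow> (nat \<Rightarrow> nat) \<Rightarrow> (nat \<Rightarrow> 'a) \<Rightarrow> nat \<Rightarrow> nat \<Rightarrow> 'a \<times> nat" where
  "stack_coords b k e0 0 i = (e0 i, 0)"
| "stack_coords b k e0 (Suc n) i =
    (let (x, c) = stack_coords b k e0 n (i mod k (Suc n)); (x', q) = b n (x, i div k (Suc n))
     in (x', q * k n + c))"

lemma (in group) folner_tower_exists:
  assumes fg: "fin_gen_group G" and am: "amenable_group G"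
  shows "\<exists>d L C. folner_tower G d L C"
proof -
  obtain E :: "nat \<Rightarrow> 'a set" where E: "\<And>n. finite (E n) \<and> E n \<subseteq> carrier G" and inc: "incseq E"
    and cover: "(\<Union>n. E n) = carrier G"
    using fin_gen_exhaustion[OF fg] by blast
  obtain Y :: "nat \<Rightarrow> 'a set" where Y: "\<And>n. finite (Y n)" "\<And>n. Y n \<noteq> {}" "\<And>n. Y n \<subseteq> carrier G"
    and bd: "\<And>n s. s \<in> E n \<Longrightarrow> real (card {x\<in>Y n. s \<otimes> x \<notin> Y n}) \<le> 1 / 2 ^ n * card (Y n)"
    and cl: "\<And>n. close_sets (E n) (1 / 2 ^ n) (Y n) (Y (Suc n))"
    using folner_chain[OF am E inc] by blast
  from cl have "\<forall>n. \<exists>b. bij_betw b (Y n \<times> {..<card (Y (Suc n))}) (Y (Suc n) \<times> {..<card (Y n)}) \<and>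
    (\<forall>s\<in>E n. real (card {p \<in> Y n \<times> {..<card (Y (Suc n))}. \<not> commute_at (Y n) b s p})
      \<le> 1 / 2 ^ n * card (Y n) * card (Y (Suc n)))"
    unfolding close_sets_def by blast
  from choice[OF this] obtain b where "\<forall>n. bij_betw (b n) (Y n \<times> {..<card (Y (Suc n))}) (Y (Suc n) \<times> {..<card (Y n)}) \<and>
    (\<forall>s\<in>E n. real (card {p \<in> Y n \<times> {..<card (Y (Suc n))}. \<not> commute_at (Y n) (b n) s p})
      \<le> 1 / 2 ^ n * card (Y n) * card (Y (Suc n)))" ..
  then have b: "\<And>n. bij_betw (b n) (Y n \<times> {..<card (Y (Suc n))}) (Y (Suc n) \<times> {..<card (Y n)})"
    and bc: "\<And>n s. s \<in> E n \<Longrightarrow> real (card {p \<in> Y n \<times> {..<card (Y (Suc n))}. \<not> commute_at (Y n) (b n) s p})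
      \<le> 1 / 2 ^ n * card (Y n) * card (Y (Suc n))"
    by blast+
  define k where "k n = (\<Prod>i<n. card (Y i))" for n
  define d where "d n = k (Suc n)" for n
  have cY: "card (Y n) > 0" for n using Y by (simp add: card_gt_0_iff)
  have k_pos: "k n > 0" for n using cY by (simp add: k_def prod_pos)
  have d_eq: "d n = card (Y n) * k n" for n by (simp add: d_def k_def)
  obtain e0 where e0: "bij_betw e0 {..<card (Y 0)} (Y 0)"
    using ex_bij_betw_nat_finite[OF Y(1)[of 0]] by (auto simp: lessThan_atLeast0)
  define e where "e = stack_coords b k e0"
  have e_Suc: "e (Suc n) i = (fst (b n (fst (e n (i mod d n)), i div d n)),
      snd (b n (fst (e n (i mod d n)), i div d n)) * k n + snd (e n (i mod d n)))" for n i
    by (simp add: e_def d_def case_prod_beta Let_def)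
  have dd: "d (Suc n) = card (Y (Suc n)) * d n" for n by (simp add: d_def k_def)
  have dpos: "d n > 0" for n by (simp add: d_def k_pos)
  \<comment> \<open>The digits of the copy number can be separated because the lower one is below
    \<open>k n\<close>; injectivity then follows from that of \<open>b n\<close> and of the previous
    level. Surjectivity comes from equal cardinalities.\<close>
  have e: "bij_betw (e n) {..<d n} (Y n \<times> {..<k n})" for n
  proof (induction n)
    case 0
    have "bij_betw (\<lambda>i. (e0 i, 0)) {..<d 0} (Y 0 \<times> {..<Suc 0})"
      using e0 by (auto simp: bij_betw_def inj_on_def d_eq k_def)
    then show ?case by (simp add: e_def k_def)
  next
    case (Suc n)
    have into: "fst (e n (i mod d n)) \<in> Y n" "snd (e n (i mod d n)) < k n"
      "i div d n < card (Y (Suc n))"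
      "b n (fst (e n (i mod d n)), i div d n) \<in> Y (Suc n) \<times> {..<card (Y n)}" if "i < d (Suc n)" for i
    proof -
      have "i mod d n < d n" using dpos by simp
      then have "e n (i mod d n) \<in> Y n \<times> {..<k n}" using bij_betwE[OF Suc.IH] by blast
      moreover have "i div d n < card (Y (Suc n))" using that dpos by (simp add: dd less_mult_imp_div_less)
      ultimately show "fst (e n (i mod d n)) \<in> Y n" "snd (e n (i mod d n)) < k n"
        "i div d n < card (Y (Suc n))"
        "b n (fst (e n (i mod d n)), i div d n) \<in> Y (Suc n) \<times> {..<card (Y n)}"
        using bij_betwE[OF b[of n]] by (auto simp: mem_Times_iff)
    qed
    have "inj_on (e (Suc n)) {..<d (Suc n)}"
    proof (rule inj_onI)
      fix i j assume ij: "i \<in> {..<d (Suc n)}" "j \<in> {..<d (Suc n)}" and eq: "e (Suc n) i = e (Suc n) j"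
      define p q where "p = b n (fst (e n (i mod d n)), i div d n)" and "q = b n (fst (e n (j mod d n)), j div d n)"
      have 1: "fst p = fst q" "snd p * k n + snd (e n (i mod d n)) = snd q * k n + snd (e n (j mod d n))"
        using eq by (simp_all add: e_Suc p_def q_def)
      have c: "snd (e n (i mod d n)) < k n" "snd (e n (j mod d n)) < k n" using into ij by auto
      have "(snd p * k n + snd (e n (i mod d n))) div k n = snd p"
        "(snd q * k n + snd (e n (j mod d n))) div k n = snd q"
        using c by (simp_all add: div_mult_self3)
      then have 2: "snd p = snd q" using 1(2) by metis
      then have 3: "snd (e n (i mod d n)) = snd (e n (j mod d n))" using 1(2) by simp
      have "p = q" using 1(1) 2 by (simp add: prod_eq_iff)
      then have "(fst (e n (i mod d n)), i div d n) = (fst (e n (j mod d n)), j div d n)"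
        unfolding p_def q_def using bij_betw_imp_inj_on[OF b[of n]] into ij
        by (elim inj_onD) auto
      then have "e n (i mod d n) = e n (j mod d n)" "i div d n = j div d n" using 3 by (auto simp: prod_eq_iff)
      moreover have "i mod d n < d n" "j mod d n < d n" using dpos by auto
      ultimately have "i mod d n = j mod d n" "i div d n = j div d n"
        using bij_betw_imp_inj_on[OF Suc.IH] by (auto dest: inj_onD)
      then show "i = j" by (metis div_mult_mod_eq)
    qed
    moreover have "e (Suc n) ` {..<d (Suc n)} \<subseteq> Y (Suc n) \<times> {..<k (Suc n)}"
    proof (rule image_subsetI)
      fix i assume "i \<in> {..<d (Suc n)}"
      then have i: "fst (b n (fst (e n (i mod d n)), i div d n)) \<in> Y (Suc n)"
        "snd (b n (fst (e n (i mod d n)), i div d n)) < card (Y n)" "snd (e n (i mod d n)) < k n"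
        using into by (auto simp: mem_Times_iff)
      have "snd (b n (fst (e n (i mod d n)), i div d n)) * k n + snd (e n (i mod d n)) <
        Suc (snd (b n (fst (e n (i mod d n)), i div d n))) * k n" using i by simp
      also have "\<dots> \<le> card (Y n) * k n" using i by (intro mult_le_mono1) simp
      also have "\<dots> = k (Suc n)" by (simp add: k_def)
      finally show "e (Suc n) i \<in> Y (Suc n) \<times> {..<k (Suc n)}" using i by (simp add: e_Suc)
    qed
    moreover have "card {..<d (Suc n)} = card (Y (Suc n) \<times> {..<k (Suc n)})"
      by (simp add: d_eq card_cartesian_product)
    ultimately show ?case
      using Y by (simp add: bij_betw_def card_image card_subset_eq)
  qed
  define L where "L n i = fst (e n i)" for n i
  define C where "C n i = snd (e n i)" for n i
  have eY: "e n i \<in> Y n \<times> {..<k n}" if "i < d n" for n i using bij_betwE[OF e[of n]] that by auto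
  have eS: "\<exists>i<d n. e n i = p" if "p \<in> Y n \<times> {..<k n}" for n p
    using that bij_betw_imp_surj_on[OF e[of n]] by (metis imageE lessThan_iff)
  have dvd: "d n dvd d (Suc n)" for n by (simp add: dd)
  have eL: "e n i = (L n i, C n i)" for n i by (simp add: L_def C_def)
  interpret coordinate_tower G d L C
  proof
    show "L n i \<in> carrier G" if "i < d n" for i n
      using eY[OF that] Y(3)[of n] by (auto simp: L_def mem_Times_iff)
    show "i = j" if "i < d n" "j < d n" "L n i = L n j" "C n i = C n j" for i n j
      by (rule inj_onD[OF bij_betw_imp_inj_on[OF e[of n]]]) (use that in \<open>simp_all add: eL\<close>)
  qed (use dpos dvd in auto)
  have inn: "inner n s j" if "j < d n" "s \<otimes> L n j \<in> Y n" for n s j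
    using eS[of "(s \<otimes> L n j, C n j)" n] eY[OF that(1)] that(2) by (auto simp: inner_def moves_def eL)
  have I: "real (card {j. j < d n \<and> \<not> inner n s j}) \<le> d n / 2 ^ n" if s: "s \<in> E n" for n s
  proof -
    have "card {j. j < d n \<and> \<not> inner n s j} \<le> card ({x\<in>Y n. s \<otimes> x \<notin> Y n} \<times> {..<k n})"
    proof (rule card_inj_on_le[where f = "e n"])
      show "inj_on (e n) {j. j < d n \<and> \<not> inner n s j}"
        using bij_betw_imp_inj_on[OF e[of n]] by (rule inj_on_subset) auto
      show "e n ` {j. j < d n \<and> \<not> inner n s j} \<subseteq> {x\<in>Y n. s \<otimes> x \<notin> Y n} \<times> {..<k n}"
        using inn eY by (fastforce simp: L_def mem_Times_iff)
      show "finite ({x\<in>Y n. s \<otimes> x \<notin> Y n} \<times> {..<k n})" using Y by simp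
    qed
    then have "real (card {j. j < d n \<and> \<not> inner n s j}) \<le> real (card {x\<in>Y n. s \<otimes> x \<notin> Y n}) * k n"
      by (simp add: card_cartesian_product flip: of_nat_mult)
    also have "\<dots> \<le> (1 / 2 ^ n * card (Y n)) * k n" using bd[OF s] by (intro mult_right_mono) auto
    finally show ?thesis by (simp add: d_eq)
  qed
  have coh: "coherent n s j"
    if "j < d (Suc n)" "commute_at (Y n) (b n) s (L n (j mod d n), j div d n)" for n s j
  proof -
    have "j mod d n < d n" using dpos by simp
    then have ej: "e n (j mod d n) \<in> Y n \<times> {..<k n}" by (rule eY)
    moreover have "s \<otimes> L n (j mod d n) \<in> Y n" using that(2) by (simp add: commute_at_def)
    ultimately obtain r where r: "r < d n" "e n r = (s \<otimes> L n (j mod d n), C n (j mod d n))"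
      using eS[of "(s \<otimes> L n (j mod d n), C n (j mod d n))" n] by (auto simp: eL)
    \<comment> \<open>The index in the block of \<open>j\<close> whose point of level
      \<open>n\<close> is the translate by \<open>s\<close>.\<close>
    define i where "i = j div d n * d n + r"
    have i: "i div d n = j div d n" "i mod d n = r" using r(1) by (simp_all add: i_def)
    have "j div d n < card (Y (Suc n))" using that dpos by (simp add: dd less_mult_imp_div_less)
    then have "i div d n < card (Y (Suc n))" using i by simp
    then have "i < d (Suc n)" unfolding dd using dpos[of n] by (simp add: div_less_iff_less_mult)
    moreover have "e (Suc n) i = (s \<otimes> fst (e (Suc n) j), snd (e (Suc n) j))"
      using that(2) r(2) by (simp add: e_Suc i commute_at_def L_def C_def)
    ultimately show ?thesis unfolding coherent_def moves_def
      using i r(2) by (intro exI[of _ i]) (simp add: eL)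
  qed
  have H: "real (card {j. j < d (Suc n) \<and> \<not> coherent n s j}) \<le> d (Suc n) / 2 ^ n" if s: "s \<in> E n" for n s
  proof -
    let ?W = "{p \<in> Y n \<times> {..<card (Y (Suc n))}. \<not> commute_at (Y n) (b n) s p}"
    \<comment> \<open>Each failure of commutation of \<open>b n\<close> is repeated at most once for
      each of the \<open>k n\<close> copies.\<close>
    have "card {j. j < d (Suc n) \<and> \<not> coherent n s j} \<le> card (?W \<times> {..<k n})"
    proof (rule card_inj_on_le[where f = "\<lambda>j. ((L n (j mod d n), j div d n), C n (j mod d n))"])
      show "inj_on (\<lambda>j. ((L n (j mod d n), j div d n), C n (j mod d n))) {j. j < d (Suc n) \<and> \<not> coherent n s j}"
      proof (rule inj_onI)
        fix i j assume "((L n (i mod d n), i div d n), C n (i mod d n)) = ((L n (j mod d n), j div d n), C n (j mod d n))"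
        then have "i mod d n = j mod d n" "i div d n = j div d n"
          using LC_inj[of "i mod d n" n "j mod d n"] dpos by auto
        then show "i = j" by (metis div_mult_mod_eq)
      qed
      show "(\<lambda>j. ((L n (j mod d n), j div d n), C n (j mod d n))) ` {j. j < d (Suc n) \<and> \<not> coherent n s j}
          \<subseteq> ?W \<times> {..<k n}"
      proof (rule image_subsetI)
        fix j assume j: "j \<in> {j. j < d (Suc n) \<and> \<not> coherent n s j}"
        have "j mod d n < d n" using dpos by simp
        then have "e n (j mod d n) \<in> Y n \<times> {..<k n}" by (rule eY)
        moreover have "j div d n < card (Y (Suc n))" using j dpos by (simp add: dd less_mult_imp_div_less)
        ultimately show "((L n (j mod d n), j div d n), C n (j mod d n)) \<in> ?W \<times> {..<k n}"
          using coh[of j n s] j by (auto simp: eL)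
      qed
      show "finite (?W \<times> {..<k n})" using Y by simp
    qed
    then have "real (card {j. j < d (Suc n) \<and> \<not> coherent n s j}) \<le> real (card ?W) * k n"
      by (simp add: card_cartesian_product flip: of_nat_mult)
    also have "\<dots> \<le> (1 / 2 ^ n * card (Y n) * card (Y (Suc n))) * k n" using bc[OF s] by (intro mult_right_mono) auto
    finally show ?thesis by (simp add: dd) (simp add: d_eq mult_ac)
  qed
  have "folner_tower G d L C"
  proof
    fix s assume "s \<in> carrier G"
    then obtain N where "s \<in> E N" using cover by auto
    then have "s \<in> E n" if "n \<ge> N" for n using incseqD[OF inc that] by auto
    then show "\<exists>N. \<forall>n\<ge>N. real (card {j. j < d n \<and> \<not> inner n s j}) \<le> d n / 2 ^ n"
      "\<exists>N. \<forall>n\<ge>N. real (card {j. j < d (Suc n) \<and> \<not> coherent n s j}) \<le> d (Suc n) / 2 ^ n"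
      using I H by blast+
  qed
  then show ?thesis by blast
qed

subsection \<open>The embedding\<close>

text \<open>Greedy choice: picking \<open>v\<close> excludes only \<open>v\<close> and its at most
  \<open>2 * D\<close> neighbours in the two directions. Edges will mark nonzero matrix entries, so
  an independent set selects a diagonal submatrix.\<close>

lemma exists_large_independent_subset:
  assumes "finite V" and "\<And>v. v \<in> V \<Longrightarrow> card {w\<in>V. r v w} \<le> D" "\<And>v. v \<in> V \<Longrightarrow> card {w\<in>V. r w v} \<le> D"
  shows "\<exists>J\<subseteq>V. (\<forall>v\<in>J. \<forall>w\<in>J. v \<noteq> w \<longrightarrow> \<not> r v w) \<and> card V \<le> (2 * D + 1) * card J"
  using assms
proof (induction V rule: finite_psubset_induct)
  case (psubset V)
  show ?case
  proof (cases "V = {}")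
    case False
    then obtain v where v: "v \<in> V" by blast
    let ?K = "insert v ({w\<in>V. r v w} \<union> {w\<in>V. r w v})"
    have "card {w\<in>V - ?K. r u w} \<le> D" "card {w\<in>V - ?K. r w u} \<le> D" if "u \<in> V" for u
      using psubset.prems[OF that] psubset.hyps
      by (auto intro: order_trans[OF card_mono, rotated -1])
    then obtain J where J: "J \<subseteq> V - ?K" "\<forall>v\<in>J. \<forall>w\<in>J. v \<noteq> w \<longrightarrow> \<not> r v w" "card (V - ?K) \<le> (2 * D + 1) * card J"
      using psubset.IH[of "V - ?K"] v by blast
    have "finite J" "v \<notin> J" using J(1) psubset.hyps finite_subset by blast+
    have "card ?K \<le> Suc (card ({w\<in>V. r v w} \<union> {w\<in>V. r w v}))"
      using psubset.hyps by (simp add: card_insert_if)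
    also have "\<dots> \<le> Suc (D + D)"
      using card_Un_le[of "{w\<in>V. r v w}" "{w\<in>V. r w v}"] psubset.prems[OF v] by linarith
    finally have "card ?K \<le> 2 * D + 1" by simp
    moreover have "card V \<le> card (V - ?K) + card ?K"
      using psubset.hyps by (intro order_trans[OF card_mono card_Un_le]) auto
    ultimately have "card V \<le> (2 * D + 1) * card J + (2 * D + 1)" using J(3) by linarith
    moreover have "card (insert v J) = Suc (card J)" using \<open>finite J\<close> \<open>v \<notin> J\<close> by simp
    ultimately have "card V \<le> (2 * D + 1) * card (insert v J)" by simp
    moreover have "insert v J \<subseteq> V" using J(1) v by blast
    moreover have "\<forall>u\<in>insert v J. \<forall>w\<in>insert v J. u \<noteq> w \<longrightarrow> \<not> r u w" using J(1,2) by blast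
    ultimately show ?thesis by blast
  qed simp
qed

context coordinate_tower
begin

text \<open>The matrix of left multiplication by \<open>a\<close>, compressed to the \<open>n\<close>-th level.\<close>
definition compression :: "nat \<Rightarrow> ('a \<Rightarrow> 'k::field) \<Rightarrow> 'k mat" where
  "compression n a = mat (d n) (d n)
     (\<lambda>(i, j). if C n i = C n j then a (L n i \<otimes> inv (L n j)) else 0)"

lemma compression_carrier [simp]: "compression n a \<in> carrier_mat (d n) (d n)"
  by (simp add: compression_def)

lemma compression_dim [simp]: "dim_row (compression n a) = d n" "dim_col (compression n a) = d n"
  by (simp_all add: compression_def)

lemma compression_index: "i < d n \<Longrightarrow> j < d n \<Longrightarrow>
    compression n a $$ (i, j) = (if C n i = C n j then a (L n i \<otimes> inv (L n j)) else 0)"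
  by (simp add: compression_def)

lemma moves_iff:
  assumes "i < d n" "j < d n" "s \<in> carrier G"
  shows "moves n s i j \<longleftrightarrow> C n i = C n j \<and> L n i \<otimes> inv (L n j) = s"
  unfolding moves_def using assms L_carrier[of i n] L_carrier[of j n]
  by (metis inv_solve_right' m_closed inv_closed)

lemma moves_unique:
  assumes "moves n s i j" "moves n s i' j" "i < d n" "i' < d n"
  shows "i = i'"
  using assms LC_inj[of i n i'] by (simp add: moves_def)

lemma nrank_le_card_cols:
  assumes A: "A \<in> carrier_mat (d n) (d n)"
    and z: "\<And>i j. i < d n \<Longrightarrow> j < d n \<Longrightarrow> j \<notin> W \<Longrightarrow> A $$ (i, j) = 0" and W: "finite W"
  shows "nrank n A \<le> real (card W) / d n"
proof -
  have "{j. j < d n \<and> col A j \<noteq> 0\<^sub>v (d n)} \<subseteq> W"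
    using A z by (auto intro!: eq_vecI)
  then have "vec_space.rank (d n) A \<le> card W"
    using vec_space.rank_le_card_nonzero_cols[OF A] card_mono[OF W] by (meson order_trans)
  then show ?thesis by (simp add: nrank_def divide_right_mono)
qed

lemma card_bad_le:
  fixes c :: real
  assumes "finite S" "\<And>s. s \<in> S \<Longrightarrow> real (card {j. j < m \<and> \<not> Q s j}) \<le> c"
  shows "real (card {j. j < m \<and> (\<exists>s\<in>S. \<not> Q s j)}) \<le> card S * c"
proof -
  have "{j. j < m \<and> (\<exists>s\<in>S. \<not> Q s j)} = (\<Union>s\<in>S. {j. j < m \<and> \<not> Q s j})" by auto
  then have "card {j. j < m \<and> (\<exists>s\<in>S. \<not> Q s j)} \<le> (\<Sum>s\<in>S. card {j. j < m \<and> \<not> Q s j})"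
    using card_UN_le[OF assms(1)] by metis
  then have "real (card {j. j < m \<and> (\<exists>s\<in>S. \<not> Q s j)}) \<le> (\<Sum>s\<in>S. real (card {j. j < m \<and> \<not> Q s j}))"
    by (simp flip: of_nat_sum)
  also have "\<dots> \<le> (\<Sum>s\<in>S. c)" by (rule sum_mono) (rule assms(2))
  finally show ?thesis by simp
qed

text \<open>Column \<open>j\<close> holds \<open>a g\<close> in the row reached from
  \<open>j\<close> by \<open>g\<close>. Coherence puts that row at the same index in both matrices
  for every \<open>g\<close> in the support.\<close>

lemma coherent_column:
  assumes S: "\<And>g. a g \<noteq> 0 \<Longrightarrow> g \<in> carrier G \<and> coherent n g j" and ij: "i < d (Suc n)" "j < d (Suc n)"
  shows "up n (Suc n) (compression n a) $$ (i, j) = compression (Suc n) a $$ (i, j)"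
proof -
  have md: "i mod d n < d n" "j mod d n < d n" using pos by auto
  have dd: "d (Suc n) div d n * d n = d (Suc n)" using dvd_Suc by simp
  let ?s = "L (Suc n) i \<otimes> inv (L (Suc n) j)" and ?t = "L n (i mod d n) \<otimes> inv (L n (j mod d n))"
  have lhs: "up n (Suc n) (compression n a) $$ (i, j) =
      (if i div d n = j div d n \<and> C n (i mod d n) = C n (j mod d n) then a ?t else 0)"
    using ij md by (simp add: up_def dup_index dd compression_index)
  have rhs: "compression (Suc n) a $$ (i, j) = (if C (Suc n) i = C (Suc n) j then a ?s else 0)"
    using ij by (simp add: compression_index)
  have "i div d n = j div d n \<and> moves n g (i mod d n) (j mod d n) \<longleftrightarrow> moves (Suc n) g i j"
    if g: "a g \<noteq> 0" for g
  proof -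
    obtain i0 where i0: "i0 < d (Suc n)" "i0 div d n = j div d n"
      "moves n g (i0 mod d n) (j mod d n)" "moves (Suc n) g i0 j"
      using S[OF g] by (auto simp: coherent_def)
    have i0m: "i0 mod d n < d n" using pos by simp
    show ?thesis
    proof
      assume "i div d n = j div d n \<and> moves n g (i mod d n) (j mod d n)"
      then have "i mod d n = i0 mod d n" "i div d n = i0 div d n"
        using moves_unique[OF _ i0(3) md(1) i0m] i0(2) by auto
      then have "i = i0" by (metis div_mult_mod_eq)
      then show "moves (Suc n) g i j" using i0 by simp
    next
      assume "moves (Suc n) g i j"
      then have "i = i0" using moves_unique i0 ij by blast
      then show "i div d n = j div d n \<and> moves n g (i mod d n) (j mod d n)" using i0 by simp
    qed
  qed
  then have key: "i div d n = j div d n \<and> C n (i mod d n) = C n (j mod d n) \<and> ?t = g \<longleftrightarrow>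
      C (Suc n) i = C (Suc n) j \<and> ?s = g" if "a g \<noteq> 0" for g
    using moves_iff[OF md, of g] moves_iff[OF ij, of g] S[OF that] that by blast
  \<comment> \<open>A nonzero coefficient on either side forces the other side to match; if both
    coefficients vanish, both entries are 0.\<close>
  show ?thesis unfolding lhs rhs using key[of ?s] key[of ?t] by metis
qed

lemma dist_compression_Suc:
  assumes S: "finite S" "S \<subseteq> carrier G" "\<And>g. g \<notin> S \<Longrightarrow> a g = 0"
    and c: "\<And>s. s \<in> S \<Longrightarrow> real (card {j. j < d (Suc n) \<and> \<not> coherent n s j}) \<le> d (Suc n) / 2 ^ n"
  shows "ua_dist B P (n, [compression n a]) (Suc n, [compression (Suc n) a]) \<le> card S / 2 ^ n"
proof -
  let ?W = "{j. j < d (Suc n) \<and> (\<exists>s\<in>S. \<not> coherent n s j)}"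
  have "nrank (Suc n) (up n (Suc n) (compression n a) - compression (Suc n) a) \<le> real (card ?W) / d (Suc n)"
  proof (rule nrank_le_card_cols)
    fix i j assume ij: "i < d (Suc n)" "j < d (Suc n)" "j \<notin> ?W"
    then have "up n (Suc n) (compression n a) $$ (i, j) = compression (Suc n) a $$ (i, j)"
      using S by (intro coherent_column) auto
    then show "(up n (Suc n) (compression n a) - compression (Suc n) a) $$ (i, j) = 0"
      using ij by simp
  qed auto
  also have "\<dots> \<le> (card S * (d (Suc n) / 2 ^ n)) / d (Suc n)"
    by (intro divide_right_mono card_bad_le S c) auto
  also have "\<dots> = card S / 2 ^ n" using pos[of "Suc n"] by simp
  finally show ?thesis by (simp add: dist_next_level)
qed

text \<open>Entry \<open>(i, j)\<close> of the matrix product sums only over intermediate points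
  inside the level. If \<open>j\<close> is inner for the support of \<open>b\<close>, every nonzero
  term of the convolution passes through such a point, so none is lost. The support of
  \<open>b\<close> decides because \<open>b\<close> acts on column \<open>j\<close> first.\<close>

lemma nrank_compression_mult:
  fixes a b :: "'a \<Rightarrow> 'k::field"
  assumes a: "a \<in> carrier (group_algebra G)"
    and S: "finite S" "S \<subseteq> carrier G" "\<And>g. g \<notin> S \<Longrightarrow> b g = 0"
    and c: "\<And>s. s \<in> S \<Longrightarrow> real (card {j. j < d n \<and> \<not> inner n s j}) \<le> d n / 2 ^ n"
  shows "nrank n (compression n (a \<otimes>\<^bsub>group_algebra G\<^esub> b) - compression n a * compression n b) \<le> card S / 2 ^ n"
proof -
  let ?W = "{j. j < d n \<and> (\<exists>s\<in>S. \<not> inner n s j)}"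
  have cm: "compression n a * compression n b \<in> carrier_mat (d n) (d n)"
    by (rule mult_carrier_mat[OF compression_carrier compression_carrier])
  have "nrank n (compression n (a \<otimes>\<^bsub>group_algebra G\<^esub> b) - compression n a * compression n b)
      \<le> real (card ?W) / d n"
  proof (rule nrank_le_card_cols)
    fix i j assume ij: "i < d n" "j < d n" "j \<notin> ?W"
    have Li: "L n i \<in> carrier G" and Lj: "L n j \<in> carrier G" using ij L_carrier by auto
    have fa: "finite {h. a h \<noteq> 0}" and ca: "\<And>h. a h \<noteq> 0 \<Longrightarrow> h \<in> carrier G"
      using a by (auto simp: group_algebra_def)
    let ?g = "L n i \<otimes> inv (L n j)"
    have gc: "?g \<in> carrier G" using Li Lj by simp
    have prod: "(compression n a * compression n b) $$ (i, j) =
        (\<Sum>l<d n. (if C n i = C n l then a (L n i \<otimes> inv (L n l)) else 0) *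
          (if C n l = C n j then b (L n l \<otimes> inv (L n j)) else 0))"
      using ij by (simp add: scalar_prod_def compression_index lessThan_atLeast0)
    have "(compression n a * compression n b) $$ (i, j) =
        (if C n i = C n j then \<Sum>h\<in>{h. a h \<noteq> 0}. a h * b (inv h \<otimes> ?g) else 0)"
    proof (cases "C n i = C n j")
      case False
      then show ?thesis unfolding prod by (auto intro!: sum.neutral)
    next
      case True
      \<comment> \<open>Intermediate points with a nonzero contribution;
        \<open>L n i \<otimes> inv (L n l)\<close> turns them into the summation index
        \<open>h\<close> of the convolution.\<close>
      define T where "T = {l. l < d n \<and> C n l = C n j \<and> a (L n i \<otimes> inv (L n l)) \<noteq> 0
        \<and> b (L n l \<otimes> inv (L n j)) \<noteq> 0}"
      have cancel: "inv (L n i \<otimes> inv (L n l)) \<otimes> ?g = L n l \<otimes> inv (L n j)" if "l \<in> T" for l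
      proof -
        have Ll: "L n l \<in> carrier G" using that by (simp add: T_def L_carrier)
        have "inv (L n i \<otimes> inv (L n l)) \<otimes> ?g = L n l \<otimes> (inv (L n i) \<otimes> L n i) \<otimes> inv (L n j)"
          using Li Lj Ll by (simp only: inv_mult_group inv_inv m_assoc inv_closed m_closed)
        then show ?thesis using Li Ll by simp
      qed
      have "(compression n a * compression n b) $$ (i, j) =
          (\<Sum>l\<in>T. a (L n i \<otimes> inv (L n l)) * b (L n l \<otimes> inv (L n j)))"
        unfolding prod by (rule sum.mono_neutral_cong_right) (auto simp: T_def True)
      also have "\<dots> = (\<Sum>l\<in>T. a (L n i \<otimes> inv (L n l)) * b (inv (L n i \<otimes> inv (L n l)) \<otimes> ?g))"
        using cancel by (intro sum.cong) auto
      also have "\<dots> = (\<Sum>h\<in>{h. a h \<noteq> 0 \<and> b (inv h \<otimes> ?g) \<noteq> 0}. a h * b (inv h \<otimes> ?g))"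
      proof (rule sum.reindex_bij_betw)
        show "bij_betw (\<lambda>l. L n i \<otimes> inv (L n l)) T {h. a h \<noteq> 0 \<and> b (inv h \<otimes> ?g) \<noteq> 0}"
        proof (rule bij_betwI')
          fix l l' assume l: "l \<in> T" and l': "l' \<in> T"
          then have Ll: "L n l \<in> carrier G" "L n l' \<in> carrier G" by (auto simp: T_def L_carrier)
          show "L n i \<otimes> inv (L n l) = L n i \<otimes> inv (L n l') \<longleftrightarrow> l = l'"
          proof
            assume "L n i \<otimes> inv (L n l) = L n i \<otimes> inv (L n l')"
            then have "inv (L n l) = inv (L n l')" using Li Ll by simp
            then have "L n l = L n l'" using Ll by (metis inv_inv)
            then show "l = l'" using l l' LC_inj[of l n l'] by (simp add: T_def)
          qed simp
        next
          fix l assume l: "l \<in> T"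
          then show "L n i \<otimes> inv (L n l) \<in> {h. a h \<noteq> 0 \<and> b (inv h \<otimes> ?g) \<noteq> 0}"
            using cancel[OF l] by (simp add: T_def)
        next
          fix h assume h: "h \<in> {h. a h \<noteq> 0 \<and> b (inv h \<otimes> ?g) \<noteq> 0}"
          then have hc: "h \<in> carrier G" using ca by auto
          have "inv h \<otimes> ?g \<in> S" using h S(3) by auto
          \<comment> \<open>Innerness supplies the intermediate point for \<open>h\<close>.\<close>
          then have "inner n (inv h \<otimes> ?g) j" using ij by auto
          then obtain l where l: "l < d n" "C n l = C n j" "L n l = inv h \<otimes> ?g \<otimes> L n j"
            by (auto simp: inner_def moves_def)
          have "L n l = inv h \<otimes> L n i" using l(3) Li Lj hc by (simp add: m_assoc)
          then have "L n i \<otimes> inv (L n l) = h" using Li hc by (simp add: inv_mult_group m_assoc[symmetric])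
          moreover have "L n l \<otimes> inv (L n j) = inv h \<otimes> ?g"
            using \<open>L n l = inv h \<otimes> L n i\<close> Li Lj hc by (simp add: m_assoc)
          ultimately show "\<exists>l\<in>T. h = L n i \<otimes> inv (L n l)" using l h by (auto simp: T_def)
        qed
      qed
      also have "\<dots> = (\<Sum>h\<in>{h. a h \<noteq> 0}. a h * b (inv h \<otimes> ?g))"
        by (rule sum.mono_neutral_left) (use fa in auto)
      finally show ?thesis using True by simp
    qed
    moreover have "compression n (a \<otimes>\<^bsub>group_algebra G\<^esub> b) $$ (i, j) =
        (if C n i = C n j then \<Sum>h\<in>{h. a h \<noteq> 0}. a h * b (inv h \<otimes> ?g) else 0)"
      using ij gc by (simp add: compression_index group_algebra_def)
    ultimately show "(compression n (a \<otimes>\<^bsub>group_algebra G\<^esub> b) - compression n a * compression n b) $$ (i, j) = 0"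
      using ij by simp
  qed (use cm in auto)
  also have "\<dots> \<le> (card S * (d n / 2 ^ n)) / d n"
    by (intro divide_right_mono card_bad_le S c) auto
  also have "\<dots> = card S / 2 ^ n" using pos[of n] by simp
  finally show ?thesis .
qed

text \<open>The row \<open>t j\<close> reached from an inner column \<open>j\<close> by
  \<open>s0\<close> carries the nonzero entry \<open>a s0\<close> there. Rows and columns have at
  most \<open>card S\<close> nonzero entries, so an independent set of at least
  \<open>card V / (2 * card S + 1)\<close> columns gives a diagonal submatrix, and \<open>V\<close>
  contains at least half of the columns. The bound is uniform in \<open>n\<close>.\<close>

lemma nrank_compression_ge:
  fixes a :: "'a \<Rightarrow> 'k::field"
  assumes S: "finite S" "S \<subseteq> carrier G" "\<And>g. g \<notin> S \<Longrightarrow> a g = 0" and s0: "a s0 \<noteq> 0"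
    and c: "real (card {j. j < d n \<and> \<not> inner n s0 j}) \<le> d n / 2"
  shows "nrank n (compression n a) \<ge> 1 / (2 * (2 * card S + 1))"
proof -
  have s0c: "s0 \<in> carrier G" using S s0 by auto
  define V where "V = {j. j < d n \<and> inner n s0 j}"
  have "\<forall>j\<in>V. \<exists>i. i < d n \<and> moves n s0 i j" by (auto simp: V_def inner_def)
  from bchoice[OF this] obtain t where t: "\<And>j. j \<in> V \<Longrightarrow> t j < d n \<and> moves n s0 (t j) j" by blast
  define r where "r v w \<longleftrightarrow> compression n a $$ (t v, w) \<noteq> 0" for v w
  have Vd: "v < d n" if "v \<in> V" for v using that by (simp add: V_def)
  have finV: "finite V" by (simp add: V_def)
  have rS: "C n w = C n (t v) \<and> L n (t v) \<otimes> inv (L n w) \<in> S" if "r v w" "v \<in> V" "w \<in> V" for v w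
    using that t Vd S(3) by (auto simp: r_def compression_index split: if_splits)
  have tinj: "v = w" if "v \<in> V" "w \<in> V" "t v = t w" for v w
  proof -
    have "C n v = C n w" "s0 \<otimes> L n v = s0 \<otimes> L n w"
      using t[OF that(1)] t[OF that(2)] that(3) by (auto simp: moves_def)
    then show ?thesis using LC_inj[of v n w] that Vd L_carrier s0c by simp
  qed
  have out: "card {w\<in>V. r v w} \<le> card S" if v: "v \<in> V" for v
  proof (rule card_inj_on_le[where f = "\<lambda>w. L n (t v) \<otimes> inv (L n w)"])
    show "inj_on (\<lambda>w. L n (t v) \<otimes> inv (L n w)) {w\<in>V. r v w}"
    proof (rule inj_onI, elim CollectE conjE)
      fix w w' assume w: "w \<in> V" "r v w" and w': "w' \<in> V" "r v w'"
        and eq: "L n (t v) \<otimes> inv (L n w) = L n (t v) \<otimes> inv (L n w')"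
      have c: "L n (t v) \<in> carrier G" "L n w \<in> carrier G" "L n w' \<in> carrier G"
        using t[OF v] Vd w w' L_carrier by auto
      then have "inv (L n w) = inv (L n w')" using eq by simp
      then have "L n w = L n w'" using c by (metis inv_inv)
      then show "w = w'" using LC_inj[of w n w'] Vd w w' rS[OF w(2) v w(1)] rS[OF w'(2) v w'(1)] by simp
    qed
  qed (use rS v S in auto)
  have into: "card {v\<in>V. r v w} \<le> card S" if w: "w \<in> V" for w
  proof (rule card_inj_on_le[where f = "\<lambda>v. L n (t v) \<otimes> inv (L n w)"])
    show "inj_on (\<lambda>v. L n (t v) \<otimes> inv (L n w)) {v\<in>V. r v w}"
    proof (rule inj_onI, elim CollectE conjE)
      fix v v' assume v: "v \<in> V" "r v w" and v': "v' \<in> V" "r v' w"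
        and eq: "L n (t v) \<otimes> inv (L n w) = L n (t v') \<otimes> inv (L n w)"
      have c: "L n (t v) \<in> carrier G" "L n (t v') \<in> carrier G" "L n w \<in> carrier G"
        using t[OF v(1)] t[OF v'(1)] Vd w L_carrier by auto
      then have "L n (t v) = L n (t v')" using eq by simp
      then have "t v = t v'" using LC_inj[of "t v" n "t v'"] t v v' rS[OF v(2,1) w] rS[OF v'(2,1) w] by simp
      then show "v = v'" using tinj v v' by blast
    qed
  qed (use rS w S in auto)
  obtain J where J: "J \<subseteq> V" "\<forall>v\<in>J. \<forall>w\<in>J. v \<noteq> w \<longrightarrow> \<not> r v w" "card V \<le> (2 * card S + 1) * card J"
    using exists_large_independent_subset[OF finV out into] by blast
  have rk: "card J \<le> vec_space.rank (d n) (compression n a)"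
  proof (rule vec_space.rank_ge_card_diagonal[where t = t])
    show "compression n a $$ (t j, j) \<noteq> 0" if "j \<in> J" for j
    proof -
      have j: "j \<in> V" using that J by auto
      then show ?thesis using t[OF j] Vd[OF j] moves_iff[of "t j" n j s0] s0 s0c
        by (simp add: compression_index)
    qed
  qed (use J t Vd in \<open>auto simp: r_def\<close>)
  have "real (d n) / 2 \<le> card V"
  proof -
    have "{..<d n} = V \<union> {j. j < d n \<and> \<not> inner n s0 j}" by (auto simp: V_def)
    then have "card {..<d n} = card V + card {j. j < d n \<and> \<not> inner n s0 j}"
      by (simp only:) (rule card_Un_disjoint, auto simp: V_def)
    then have "real (card V) + real (card {j. j < d n \<and> \<not> inner n s0 j}) = d n"
      by (simp flip: of_nat_add)
    then show ?thesis using c by linarith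
  qed
  moreover have "real (card V) \<le> real (2 * card S + 1) * card J"
    using J(3) by (simp only: of_nat_le_iff flip: of_nat_mult)
  moreover have "real (2 * card S + 1) * card J \<le> real (2 * card S + 1) * vec_space.rank (d n) (compression n a)"
    using rk by (intro mult_left_mono) auto
  ultimately have "real (d n) / 2 \<le> real (2 * card S + 1) * vec_space.rank (d n) (compression n a)"
    by linarith
  then show ?thesis using pos[of n] by (simp add: nrank_def field_simps)
qed

definition embedding :: "('a \<Rightarrow> 'k::field) \<Rightarrow> (nat \<Rightarrow> 'k ua_elem) set" where
  "embedding a = ua_class B P (\<lambda>n. (n, [compression n a]))"

end

lemma eventually_all_finite:
  assumes "finite S" "\<And>s. s \<in> S \<Longrightarrow> \<exists>N::nat. \<forall>n\<ge>N. Q s n"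
  shows "\<exists>N. \<forall>n\<ge>N. \<forall>s\<in>S. Q s n"
  using assms eventually_ball_finite[of S "\<lambda>n s. Q s n" sequentially]
  by (auto simp: eventually_sequentially)

section \<open>The ring homomorphism and its injectivity\<close>

context folner_tower
begin

lemma support_finite: "a \<in> carrier (group_algebra G) \<Longrightarrow> finite {g. a g \<noteq> 0}"
  and support_carrier: "a \<in> carrier (group_algebra G) \<Longrightarrow> {g. a g \<noteq> 0} \<subseteq> carrier G"
  by (auto simp: group_algebra_def)

lemma compression_cauchy:
  assumes a: "a \<in> carrier (group_algebra G)"
  shows "ua_cauchy B P (\<lambda>n. (n, [compression n a]))"
proof -
  let ?S = "{g. a g \<noteq> 0}"
  obtain N where N: "\<forall>n\<ge>N. \<forall>s\<in>?S. real (card {j. j < d (Suc n) \<and> \<not> coherent n s j}) \<le> d (Suc n) / 2 ^ n"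
    using eventually_all_finite[OF support_finite[OF a], of
      "\<lambda>s n. real (card {j. j < d (Suc n) \<and> \<not> coherent n s j}) \<le> d (Suc n) / 2 ^ n"]
      mostly_coherent support_carrier[OF a] by blast
  show ?thesis
    by (rule cauchy_geometric[where N = N and c = "card ?S"])
      (use N support_finite[OF a] support_carrier[OF a] in \<open>auto intro!: elemsI dist_compression_Suc\<close>)
qed

lemma tendsto_over_power2: "(\<lambda>n. c / 2 ^ n) \<longlonglongrightarrow> (0::real)"
  using tendsto_mult[OF tendsto_const[of c] LIMSEQ_inverse_realpow_zero[of 2]]
  by (simp add: divide_inverse)

lemma embedding_one: "embedding \<one>\<^bsub>group_algebra G\<^esub> = \<one>\<^bsub>rank_completion B P :: (nat \<Rightarrow> 'k::field ua_elem) set ring\<^esub>"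
proof -
  have c1: "compression n \<one>\<^bsub>group_algebra G\<^esub> = (1\<^sub>m (d n) :: 'k mat)" for n
  proof (rule eq_matI)
    fix i j assume ij: "i < dim_row (1\<^sub>m (d n) :: 'k mat)" "j < dim_col (1\<^sub>m (d n) :: 'k mat)"
    then have "C n i = C n j \<and> L n i \<otimes> inv (L n j) = \<one> \<longleftrightarrow> i = j"
      using LC_inj[of i n j] L_carrier[of i n] L_carrier[of j n]
      by (auto simp: inv_solve_right' dest: inv_equality)
    then show "compression n \<one>\<^bsub>group_algebra G\<^esub> $$ (i, j) = (1\<^sub>m (d n) :: 'k mat) $$ (i, j)"
      using ij by (auto simp: compression_index group_algebra_def)
  qed auto
  have one: "ua_one B = (0, [1\<^sub>m (d 0) :: 'k mat])" by (simp add: ua_one_def)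
  have el: "ua_one B \<in> (ua_elems B :: 'k ua_elem set)" unfolding one by (rule elemsI) simp
  have "ua_dist B P (n, [1\<^sub>m (d n) :: 'k mat]) (ua_one B) = 0" for n
  proof -
    have "rep_at n (ua_one B) = (1\<^sub>m (d n) :: 'k mat)"
      unfolding one using dup_one[OF pos[of 0], of "d n div d 0"] div_mult_d[of 0 n] by (simp add: rep_at_def up_def)
    moreover have "rep_at n (n, [1\<^sub>m (d n)]) = (1\<^sub>m (d n) :: 'k mat)" by (simp add: rep_at_def up_self)
    moreover have "fst (ua_one B :: 'k ua_elem) \<le> n" by (simp add: one)
    ultimately show ?thesis
      using ua_dist_eq[OF elemsI[OF one_carrier_mat] el, of n n]
      by (simp add: nrank_zero minus_r_inv_mat[OF one_carrier_mat])
  qed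
  then show ?thesis unfolding embedding_def rank_completion_def
    by (simp add: c1, intro class_eqI) (auto simp: ua_equiv_def elemsI el)
qed

lemma embedding_add:
  fixes a b :: "'a \<Rightarrow> 'k::field"
  assumes a: "a \<in> carrier (group_algebra G)" and b: "b \<in> carrier (group_algebra G)"
  shows "embedding (a \<oplus>\<^bsub>group_algebra G\<^esub> b) = embedding a \<oplus>\<^bsub>rank_completion B P\<^esub> embedding b"
proof -
  have "compression n (a \<oplus>\<^bsub>group_algebra G\<^esub> b) = compression n a + compression n b" for n
    by (rule eq_matI) (auto simp: compression_index group_algebra_def)
  moreover have "ua_add B (n, [compression n a]) (n, [compression n b]) = (n, [compression n a + compression n b])" for n
    by (simp add: ua_add_eq elemsI rep_at_def up_self)
  ultimately show ?thesis unfolding embedding_def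
    by (simp add: completion_add compression_cauchy a b)
qed

text \<open>Unlike addition, multiplication is respected only in the limit: at level
  \<open>n\<close> the error has normalized rank at most the size of the support of \<open>b\<close>
  over \<open>2 ^ n\<close>, once \<open>n\<close> is large.\<close>

lemma embedding_mult:
  fixes a b :: "'a \<Rightarrow> 'k::field"
  assumes a: "a \<in> carrier (group_algebra G)" and b: "b \<in> carrier (group_algebra G)"
  shows "embedding (a \<otimes>\<^bsub>group_algebra G\<^esub> b) = embedding a \<otimes>\<^bsub>rank_completion B P\<^esub> embedding b"
proof -
  let ?S = "{g. b g \<noteq> 0}"
  obtain N where N: "\<forall>n\<ge>N. \<forall>s\<in>?S. real (card {j. j < d n \<and> \<not> inner n s j}) \<le> d n / 2 ^ n"
    using eventually_all_finite[OF support_finite[OF b], of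
      "\<lambda>s n. real (card {j. j < d n \<and> \<not> inner n s j}) \<le> d n / 2 ^ n"]
      mostly_inner support_carrier[OF b] by blast
  have cm: "compression n a * compression n b \<in> carrier_mat (d n) (d n)" for n
    by (rule mult_carrier_mat[OF compression_carrier compression_carrier])
  have eq: "ua_mult B (n, [compression n a]) (n, [compression n b]) = (n, [compression n a * compression n b])" for n
    by (simp add: ua_mult_eq elemsI rep_at_def up_self)
  have "ua_dist B P (n, [compression n (a \<otimes>\<^bsub>group_algebra G\<^esub> b)]) (n, [compression n a * compression n b])
      \<le> card ?S / 2 ^ n" if "n \<ge> N" for n
    using nrank_compression_mult[OF a support_finite[OF b] support_carrier[OF b], where n = n] N that
    by (simp add: dist_same_level cm)
  then have "ua_equiv B P (\<lambda>n. (n, [compression n (a \<otimes>\<^bsub>group_algebra G\<^esub> b)])) (\<lambda>n. (n, [compression n a * compression n b]))"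
    unfolding ua_equiv_def
    by (intro tendsto_sandwich[OF _ _ tendsto_const tendsto_over_power2[of "card ?S"]])
      (auto simp: eventually_sequentially dist_nonneg)
  then have "embedding (a \<otimes>\<^bsub>group_algebra G\<^esub> b) = ua_class B P (\<lambda>n. (n, [compression n a * compression n b]))"
    unfolding embedding_def by (intro class_eqI) (auto intro: elemsI cm)
  then show ?thesis unfolding embedding_def by (simp add: completion_mult compression_cauchy a b eq)
qed

text \<open>Equal images would force the normalized rank of the compressed difference to 0, while
  \<open>nrank_compression_ge\<close> keeps it above a positive constant that depends only on the
  two supports.\<close>

lemma embedding_inj: "inj_on embedding (carrier (group_algebra G :: ('a \<Rightarrow> 'k::field) ring))"
proof (rule inj_onI, rule ccontr)
  fix a b :: "'a \<Rightarrow> 'k"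
  assume a: "a \<in> carrier (group_algebra G)" and b: "b \<in> carrier (group_algebra G)"
    and eq: "embedding a = embedding b" and ne: "a \<noteq> b"
  have "ua_equiv B P (\<lambda>n. (n, [compression n a])) (\<lambda>n. (n, [compression n b]))"
    using class_eqD[OF compression_cauchy[OF a] compression_cauchy[OF b]] eq by (simp add: embedding_def)
  moreover have "compression n a - compression n b = compression n (\<lambda>g. a g - b g)" for n
    by (rule eq_matI) (auto simp: compression_index)
  ultimately have lim: "(\<lambda>n. nrank n (compression n (\<lambda>g. a g - b g))) \<longlonglongrightarrow> 0"
    by (simp add: ua_equiv_def dist_same_level)
  let ?S = "{g. a g \<noteq> 0} \<union> {g. b g \<noteq> 0}"
  have S: "finite ?S" "?S \<subseteq> carrier G"
    using support_finite[OF a] support_finite[OF b] support_carrier[OF a] support_carrier[OF b] by auto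
  obtain s0 where s0: "a s0 \<noteq> b s0" using ne by auto
  then have "s0 \<in> ?S" by auto
  then have "s0 \<in> carrier G" using S by blast
  then obtain N where N: "\<forall>n\<ge>N. real (card {j. j < d n \<and> \<not> inner n s0 j}) \<le> d n / 2 ^ n"
    using mostly_inner by blast
  \<comment> \<open>From level 1 on \<open>2 ^ n\<close> is at least 2, so at most half of the
    points fail to be inner, as the rank bound requires.\<close>
  have "1 / (2 * (2 * card ?S + 1)) \<le> nrank n (compression n (\<lambda>g. a g - b g))" if "n \<ge> max N 1" for n
  proof (rule nrank_compression_ge[OF S, of _ s0])
    have "(2::real) \<le> 2 ^ n" using that power_increasing[of 1 n "2::real"] by simp
    then have "d n / 2 ^ n \<le> real (d n) / 2" by (intro divide_left_mono) auto
    then show "real (card {j. j < d n \<and> \<not> inner n s0 j}) \<le> real (d n) / 2"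
      using N that by (meson max.bounded_iff order_trans)
  qed (use s0 in auto)
  then have "1 / (2 * (2 * card ?S + 1)) \<le> (0::real)"
    by (intro LIMSEQ_le_const[OF lim]) blast
  then show False by (simp add: divide_le_0_iff)
qed

lemma embedding_ring_hom:
  "embedding \<in> Ring.ring_hom (group_algebra G :: ('a \<Rightarrow> 'k::field) ring) (rank_completion B P)"
proof (rule ring_hom_memI)
  show "embedding a \<in> carrier (rank_completion B P)" if "a \<in> carrier (group_algebra G)" for a :: "'a \<Rightarrow> 'k"
    using compression_cauchy[OF that] by (auto simp: rank_completion_def embedding_def)
qed (rule embedding_mult embedding_add embedding_one; assumption?)+

end

theorem theorem2:
  fixes G :: "('g, 'b) monoid_scheme"
  assumes "fin_gen_group G" and "amenable_group G"
  shows "\<exists>(B::bratteli) P (h :: ('g \<Rightarrow> 'k::field) \<Rightarrow> (nat \<Rightarrow> 'k ua_elem) set).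
           valid_bratteli B \<and> harmonic B P \<and>
           h \<in> Ring.ring_hom (group_algebra G) (rank_completion B P) \<and>
           inj_on h (carrier (group_algebra G :: ('g \<Rightarrow> 'k) ring))"
proof -
  interpret group G using assms(1) by (simp add: fin_gen_group_def)
  obtain d L C where "folner_tower G d L C" using folner_tower_exists[OF assms] by blast
  then interpret folner_tower G d L C .
  show ?thesis using valid harmonic embedding_ring_hom embedding_inj by blast
qed

end
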